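(* Let $\{\Gamma_n\}$, defined by the triples $\{(A_n,m_n,i_n)\}$, be a sequence of normal subgroups of the discrete Heisenberg group $H$ giving rise to a Heisenberg odometer action. Let $(\alpha,\xi,\frac{\ell}{p})\in\mathbb T^3$ with $p\ge1$ and $\ell$ integers satisfying $\gcd(\ell,p)=1$. Then $(\alpha,\xi,\frac{\ell}{p})$ lies in the spectrum of the odometer action on $\overleftarrow{H/\Gamma_n}$ if and only if there exists $n$ such that $p$ divides $m_n$ and, for all $(x,y)\in A_n\mathbb Z^2$, $$y\xi+\frac{i_n(x,y)\,\ell}{p}+\frac{x}{p}\,\alpha\in\mathbb Z.$$
   Context: $H$ is the discrete Heisenberg group: the set $\mathbb Z^3$ with multiplication $(x,y,z)(x',y',z')=(x+x',y+y',z+z'+xy')$. Let $f:\mathbb Z\to H$, $f(z)=(0,0,z)$, and $g:H\to\mathbb Z^2$, $g(x,y,z)=(x,y)$. A Heisenberg odometer is given by a decreasing sequence $\Gamma_1\supset\Gamma_2\supset\cdots$ of finite index normal subgroups of $H$ with $\bigcap_n\Gamma_n=\{e\}$: it is the action of $H$ by left multiplication on the inverse limit $\overleftarrow{H/\Gamma_n}$ of the finite groups $H/\Gamma_n$ under the natural quotient maps, equipped with Haar probability measure $\mu$. The associated unitary representation on $L^2(\overleftarrow{H/\Gamma_n},\mu)$ is $(U(h)F)(\mathbf x)=F(h^{-1}\mathbf x)$. The triple $(A_n,m_n,i_n)$ of $\Gamma_n$ is: $A_n\in M(2,\mathbb Z)$ is a nonsingular matrix with $A_n\mathbb Z^2=g(\Gamma_n)$;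 $m_n=[\operatorname{Im} f:\Gamma_n\cap\operatorname{Im} f]$; $i_n:A_n\mathbb Z^2\to\mathbb Z$, $i_n(x,y)=\min\{z\ge0:(x,y,z)\in\Gamma_n\}$. Then $\Gamma_n=\{(x,y,i_n(x,y)+km_n):(x,y)\in A_n\mathbb Z^2,\ k\in\mathbb Z\}$, and $m_n$ divides all entries of $A_n$ (so that $x/p\in\mathbb Z$ for all $(x,y)\in A_n\mathbb Z^2$ when $p\mid m_n$). $\mathbb T=\mathbb R/\mathbb Z$. For $(\alpha,\xi)\in\mathbb T^2$ and $\eta=\ell/p$ with $\gcd(\ell,p)=1$, the associated $p$-dimensional irreducible unitary representation of $H$ on $\mathbb C^p$ (coordinates indexed by $j=0,\dots,p-1$) is $$(U_{(x,y,z)}v)_j=e^{2\pi i\left(y\xi+(z+jy)\eta+\left[\frac{x+j}{p}\right]\alpha\right)}\,v_{(j+x)\bmod p},$$ where $[\cdot]$ denotes the integer part (floor). It is known that all finite dimensional irreducible unitary representations of $H$ are of this form up to equivalence. One says that $(\alpha,\xi,\frac{\ell}{p})$ lies in the spectrum of an $H$ odometer action if this representation occurs (up to unitary equivalence) in the decomposition of the associated unitary representation of $H$ on $L^2(\overleftarrow{H/\Gamma_n},\mu)$ into irreducible finite dimensional representations. *)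

theory Defs
  imports "HOL-Probability.Probability" "HOL-Algebra.Coset"
begin

section \<open>The discrete Heisenberg group\<close>

type_synonym heis = "int \<times> int \<times> int"

definition Heis :: "heis monoid" where
  "Heis = \<lparr>carrier = UNIV,
           mult = (\<lambda>(x, y, z) (x', y', z'). (x + x', y + y', z + z' + x * y')),
           one = (0, 0, 0)\<rparr>"

definition heis_f :: "int \<Rightarrow> heis" where
  "heis_f z = (0, 0, z)"

definition heis_g :: "heis \<Rightarrow> int ^ 2" where
  "heis_g = (\<lambda>(x, y, z). vector [x, y])"

lemma group_Heis: "group Heis"
proof (rule groupI)
  fix h assume "h \<in> carrier Heis"
  obtain x y z where h: "h = (x, y, z)" by (cases h)
  show "\<exists>k\<in>carrier Heis. k \<otimes>\<^bsub>Heis\<^esub> h = \<one>\<^bsub>Heis\<^esub>"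
    by (rule bexI[of _ "(- x, - y, x * y - z)"]) (simp_all add: h Heis_def)
qed (auto simp: Heis_def algebra_simps)

section \<open>Heisenberg odometers\<close>

definition heis_odometer :: "(nat \<Rightarrow> heis set) \<Rightarrow> bool" where
  "heis_odometer \<Gamma> \<longleftrightarrow>
     (\<forall>n. \<Gamma> n \<lhd> Heis \<and> finite (rcosets\<^bsub>Heis\<^esub> (\<Gamma> n))) \<and>
     decseq \<Gamma> \<and> (\<Inter>n. \<Gamma> n) = {\<one>\<^bsub>Heis\<^esub>}"

definition heis_triple ::
    "heis set \<Rightarrow> int ^ 2 ^ 2 \<Rightarrow> nat \<Rightarrow> (int \<Rightarrow> int \<Rightarrow> int) \<Rightarrow> bool" where
  "heis_triple N A m i \<longleftrightarrow>
     det A \<noteq> 0 \<and> range (\<lambda>w. A *v w) = heis_g ` N \<and>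
     m = card (rcosets\<^bsub>Heis\<lparr>carrier := range heis_f\<rparr>\<^esub> (N \<inter> range heis_f)) \<and>
     (\<forall>x y. vector [x, y] \<in> range (\<lambda>w. A *v w) \<longrightarrow>
        i x y = (LEAST z. 0 \<le> z \<and> (x, y, z) \<in> N))"

text \<open>A point of the inverse limit is a sequence of cosets. When \<open>\<Gamma> (Suc n) \<subseteq> \<Gamma> n\<close>, the map
  \<open>C \<mapsto> \<Gamma> n <#> C\<close> is the natural quotient map from \<open>Heis Mod \<Gamma> (Suc n)\<close> to \<open>Heis Mod \<Gamma> n\<close>.\<close>

definition odometer_group :: "(nat \<Rightarrow> heis set) \<Rightarrow> (nat \<Rightarrow> heis set) monoid" where
  "odometer_group \<Gamma> =
     \<lparr>carrier = {X. (\<forall>n. X n \<in> carrier (Heis Mod \<Gamma> n)) \<and>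
                    (\<forall>n. X n = \<Gamma> n <#>\<^bsub>Heis\<^esub> X (Suc n))},
      mult = (\<lambda>X Y n. X n \<otimes>\<^bsub>Heis Mod \<Gamma> n\<^esub> Y n),
      one = (\<lambda>n. \<one>\<^bsub>Heis Mod \<Gamma> n\<^esub>)\<rparr>"

definition odometer_topology :: "(nat \<Rightarrow> heis set) \<Rightarrow> (nat \<Rightarrow> heis set) topology" where
  "odometer_topology \<Gamma> =
     subtopology (product_topology (\<lambda>n. discrete_topology (carrier (Heis Mod \<Gamma> n))) UNIV)
       (carrier (odometer_group \<Gamma>))"

definition odometer_act :: "heis \<Rightarrow> (nat \<Rightarrow> heis set) \<Rightarrow> (nat \<Rightarrow> heis set)" where
  "odometer_act h X = (\<lambda>n. h <#\<^bsub>Heis\<^esub> X n)"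

text \<open>For compact metrizable groups, such as the inverse limits above, every finite Borel measure
  is regular, so regularity need not be required.\<close>

definition haar_probability :: "'a monoid \<Rightarrow> 'a topology \<Rightarrow> 'a measure \<Rightarrow> bool" where
  "haar_probability G T \<mu> \<longleftrightarrow>
     prob_space \<mu> \<and> space \<mu> = carrier G \<and>
     sets \<mu> = sigma_sets (carrier G) {S. openin T S} \<and>
     (\<forall>a\<in>carrier G. \<forall>S\<in>sets \<mu>. emeasure \<mu> ((\<lambda>b. a \<otimes>\<^bsub>G\<^esub> b) ` S) = emeasure \<mu> S)"

section \<open>Complex $L^2$ spaces and unitary representations on them\<close>

text \<open>Elements of $L^2(\mu)$ are represented by square-integrable functions, and a linear subspace
  of $L^2(\mu)$ by the set of all representatives of its elements; hence subspaces are closed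
  under a.e. equality, and all equations between elements of $L^2(\mu)$ are a.e. equations.\<close>

definition L2 :: "'a measure \<Rightarrow> ('a \<Rightarrow> complex) set" where
  "L2 \<mu> = {F \<in> borel_measurable \<mu>. integrable \<mu> (\<lambda>x. (cmod (F x))\<^sup>2)}"

definition L2_inner :: "'a measure \<Rightarrow> ('a \<Rightarrow> complex) \<Rightarrow> ('a \<Rightarrow> complex) \<Rightarrow> complex" where
  "L2_inner \<mu> F G = (LINT x|\<mu>. F x * cnj (G x))"

definition L2_norm :: "'a measure \<Rightarrow> ('a \<Rightarrow> complex) \<Rightarrow> real" where
  "L2_norm \<mu> F = sqrt (LINT x|\<mu>. (cmod (F x))\<^sup>2)"

definition L2_subspace :: "'a measure \<Rightarrow> ('a \<Rightarrow> complex) set \<Rightarrow> bool" where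
  "L2_subspace \<mu> V \<longleftrightarrow>
     V \<subseteq> L2 \<mu> \<and> (\<lambda>x. 0) \<in> V \<and>
     (\<forall>F\<in>V. \<forall>G\<in>V. (\<lambda>x. F x + G x) \<in> V) \<and>
     (\<forall>c. \<forall>F\<in>V. (\<lambda>x. c * F x) \<in> V) \<and>
     (\<forall>F\<in>V. \<forall>G\<in>L2 \<mu>. (AE x in \<mu>. F x = G x) \<longrightarrow> G \<in> V)"

definition L2_finite_dim :: "'a measure \<Rightarrow> ('a \<Rightarrow> complex) set \<Rightarrow> bool" where
  "L2_finite_dim \<mu> V \<longleftrightarrow>
     (\<exists>B. finite B \<and> B \<subseteq> V \<and>
        (\<forall>F\<in>V. \<exists>c. AE x in \<mu>. F x = (\<Sum>b\<in>B. c b * b x)))"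

definition L2_trivial :: "'a measure \<Rightarrow> ('a \<Rightarrow> complex) set \<Rightarrow> bool" where
  "L2_trivial \<mu> V \<longleftrightarrow> (\<forall>F\<in>V. AE x in \<mu>. F x = 0)"

definition L2_invariant ::
    "('h \<Rightarrow> ('a \<Rightarrow> complex) \<Rightarrow> 'a \<Rightarrow> complex) \<Rightarrow> ('a \<Rightarrow> complex) set \<Rightarrow> bool" where
  "L2_invariant U V \<longleftrightarrow> (\<forall>h. \<forall>F\<in>V. U h F \<in> V)"

text \<open>Only used for finite-dimensional \<open>V\<close>, whose subspaces are all closed.\<close>

definition L2_irreducible ::
    "'a measure \<Rightarrow> ('h \<Rightarrow> ('a \<Rightarrow> complex) \<Rightarrow> 'a \<Rightarrow> complex) \<Rightarrow> ('a \<Rightarrow> complex) set \<Rightarrow> bool" where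
  "L2_irreducible \<mu> U V \<longleftrightarrow>
     L2_subspace \<mu> V \<and> L2_invariant U V \<and> \<not> L2_trivial \<mu> V \<and>
     (\<forall>W. L2_subspace \<mu> W \<and> L2_invariant U W \<and> W \<subseteq> V \<longrightarrow> L2_trivial \<mu> W \<or> W = V)"

text \<open>Hilbert-space orthogonal direct sum decompositions of $L^2(\mu)$ into irreducible
  finite-dimensional subrepresentations of \<open>U\<close>.\<close>

definition L2_decomposition ::
    "'a measure \<Rightarrow> ('h \<Rightarrow> ('a \<Rightarrow> complex) \<Rightarrow> 'a \<Rightarrow> complex) \<Rightarrow> ('a \<Rightarrow> complex) set set \<Rightarrow> bool" where
  "L2_decomposition \<mu> U \<V> \<longleftrightarrow>
     (\<forall>V\<in>\<V>. L2_finite_dim \<mu> V \<and> L2_irreducible \<mu> U V) \<and>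
     (\<forall>V\<in>\<V>. \<forall>W\<in>\<V>. V \<noteq> W \<longrightarrow> (\<forall>F\<in>V. \<forall>G\<in>W. L2_inner \<mu> F G = 0)) \<and>
     (\<forall>F\<in>L2 \<mu>. \<forall>\<epsilon>>0. \<exists>\<W> G. finite \<W> \<and> \<W> \<subseteq> \<V> \<and> (\<forall>V\<in>\<W>. G V \<in> V) \<and>
        L2_norm \<mu> (\<lambda>x. F x - (\<Sum>V\<in>\<W>. G V x)) < \<epsilon>)"

text \<open>\<open>cvecs p\<close> is $\mathbf{C}^p$ with coordinates indexed by \<open>0, \<dots>, p - 1\<close>.\<close>

definition cvecs :: "nat \<Rightarrow> (nat \<Rightarrow> complex) set" where
  "cvecs p = {v. \<forall>j\<ge>p. v j = 0}"

text \<open>Unitary equivalence of a representation \<open>\<rho>\<close> on $\mathbf{C}^p$ and the restriction of \<open>U\<close>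
  to the invariant subspace \<open>V\<close>.\<close>

definition unitarily_equivalent ::
    "'a measure \<Rightarrow> ('h \<Rightarrow> ('a \<Rightarrow> complex) \<Rightarrow> 'a \<Rightarrow> complex) \<Rightarrow> ('a \<Rightarrow> complex) set \<Rightarrow>
     nat \<Rightarrow> ('h \<Rightarrow> (nat \<Rightarrow> complex) \<Rightarrow> nat \<Rightarrow> complex) \<Rightarrow> bool" where
  "unitarily_equivalent \<mu> U V p \<rho> \<longleftrightarrow>
     (\<exists>T. (\<forall>v\<in>cvecs p. T v \<in> V) \<and>
        (\<forall>v\<in>cvecs p. \<forall>w\<in>cvecs p. AE x in \<mu>. T (\<lambda>j. v j + w j) x = T v x + T w x) \<and>
        (\<forall>c. \<forall>v\<in>cvecs p. AE x in \<mu>. T (\<lambda>j. c * v j) x = c * T v x) \<and>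
        (\<forall>v\<in>cvecs p. \<forall>w\<in>cvecs p. L2_inner \<mu> (T v) (T w) = (\<Sum>j<p. v j * cnj (w j))) \<and>
        (\<forall>F\<in>V. \<exists>v\<in>cvecs p. AE x in \<mu>. F x = T v x) \<and>
        (\<forall>h. \<forall>v\<in>cvecs p. AE x in \<mu>. T (\<rho> h v) x = U h (T v) x))"

section \<open>The spectrum of a Heisenberg odometer\<close>

definition odometer_rep ::
    "heis \<Rightarrow> ((nat \<Rightarrow> heis set) \<Rightarrow> complex) \<Rightarrow> (nat \<Rightarrow> heis set) \<Rightarrow> complex" where
  "odometer_rep h F = (\<lambda>X. F (odometer_act (inv\<^bsub>Heis\<^esub> h) X))"

text \<open>The parameters \<open>\<alpha>\<close>, \<open>\<xi>\<close> and \<open>l / p\<close> enter only modulo 1: they are real representatives of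
  elements of the circle.\<close>

definition heis_rep ::
    "real \<Rightarrow> real \<Rightarrow> int \<Rightarrow> nat \<Rightarrow> heis \<Rightarrow> (nat \<Rightarrow> complex) \<Rightarrow> nat \<Rightarrow> complex" where
  "heis_rep \<alpha> \<xi> l p = (\<lambda>(x, y, z) v j.
     if j < p then
       exp (2 * pi * \<i> * complex_of_real
              (of_int y * \<xi> + of_int (z + int j * y) * (of_int l / of_nat p) +
               of_int \<lfloor>of_int (x + int j) / real p\<rfloor> * \<alpha>)) *
       v (nat ((int j + x) mod int p))
     else 0)"

definition in_odometer_spectrum ::
    "(nat \<Rightarrow> heis set) measure \<Rightarrow> real \<Rightarrow> real \<Rightarrow> int \<Rightarrow> nat \<Rightarrow> bool" where
  "in_odometer_spectrum \<mu> \<alpha> \<xi> l p \<longleftrightarrow>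
     (\<exists>\<V>. L2_decomposition \<mu> odometer_rep \<V> \<and>
        (\<exists>V\<in>\<V>. unitarily_equivalent \<mu> odometer_rep V p (heis_rep \<alpha> \<xi> l p)))"

end

theory Submission
  imports Defs
begin

text \<open>
  Let \<open>\<rho>\<close> be the \<open>p\<close>-dimensional representation with parameters \<open>(\<alpha>, \<xi>, l / p)\<close>. It lies in the
  spectrum if and only if it is trivial on some \<open>\<Gamma> n\<close> (\<open>in_spectrum_iff_trivial_on\<close>), and the
  condition on the triple says exactly that \<open>\<rho>\<close> is trivial on \<open>\<Gamma> n\<close> (\<open>trivial_on_iff\<close>).

  The functions of the \<open>n\<close>-th component of a point of the inverse limit form a finite-dimensional
  invariant subspace \<open>level n\<close>, on which \<open>\<Gamma> n\<close> acts trivially. These subspaces increase with \<open>n\<close>.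
  Their union is dense, because the cylinder sets generate the Borel sets.

  Suppose that \<open>\<rho>\<close> occurs on an irreducible subspace \<open>V\<close>. By density, \<open>V\<close> is not orthogonal to some
  \<open>level n\<close>, so by irreducibility no nonzero vector of \<open>V\<close> is orthogonal to it. For \<open>h \<in> \<Gamma> n\<close> and
  \<open>F \<in> V\<close>, the vector \<open>U h F - F\<close> lies in \<open>V\<close> and is orthogonal to \<open>level n\<close>, since \<open>U h\<close> is unitary
  and \<open>inv h\<close> fixes \<open>level n\<close>. So \<open>U h F = F\<close>, and \<open>\<rho>\<close> is trivial on \<open>\<Gamma> n\<close>
  (\<open>trivial_on_if_occurs\<close>).

  Conversely, if \<open>\<rho>\<close> is trivial on \<open>\<Gamma> n\<close>, then the matrix coefficients \<open>h \<mapsto> sqrt p * (\<rho> (inv h) v) 0\<close>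
  are functions on \<open>Heis Mod \<Gamma> n\<close>. Sending \<open>v\<close> to its coefficient intertwines \<open>\<rho>\<close> with the odometer
  representation. It is isometric because \<open>\<rho>\<close> acts by monomial matrices: the phases of two
  coefficients at \<open>h\<close> cancel in the inner product, and the coordinate \<open>- x mod p\<close> that they read off
  at \<open>h = (x, y, z)\<close> is equidistributed (\<open>coef_inner\<close>). So \<open>\<rho>\<close> occurs on a subspace of \<open>level n\<close>.
  Decomposing its orthogonal complement in \<open>level n\<close>, and that of each level in the next, extends
  this subspace to a decomposition of the whole space (\<open>decomposition_from_first\<close>).
\<close>

section \<open>Square-integrable functions up to almost everywhere equality\<close>

lemma L2_I: "F \<in> borel_measurable M \<Longrightarrow> integrable M (\<lambda>x. (cmod (F x))\<^sup>2) \<Longrightarrow> F \<in> L2 M"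
  by (simp add: L2_def)

lemma L2_measurable [measurable_dest]: "F \<in> L2 M \<Longrightarrow> F \<in> borel_measurable M"
  by (simp add: L2_def)

lemma L2_norm_sq_integrable: "F \<in> L2 M \<Longrightarrow> integrable M (\<lambda>x. (cmod (F x))\<^sup>2)"
  by (simp add: L2_def)

lemma L2_zero [simp]: "(\<lambda>x. 0) \<in> L2 M"
  by (simp add: L2_def)

lemma cmod_add_sq_le: "(cmod (a + b))\<^sup>2 \<le> 2 * (cmod a)\<^sup>2 + 2 * (cmod b)\<^sup>2"
proof -
  have "(cmod (a + b))\<^sup>2 \<le> (cmod a + cmod b)\<^sup>2"
    by (intro power_mono norm_triangle_ineq) auto
  also have "\<dots> \<le> 2 * (cmod a)\<^sup>2 + 2 * (cmod b)\<^sup>2"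
    using zero_le_power2[of "cmod a - cmod b"] by (simp add: power2_eq_square algebra_simps)
  finally show ?thesis .
qed

lemma L2_add [intro]:
  assumes "F \<in> L2 M" "G \<in> L2 M"
  shows "(\<lambda>x. F x + G x) \<in> L2 M"
proof (rule L2_I)
  note [measurable] = L2_measurable[OF assms(1)] L2_measurable[OF assms(2)]
  show "(\<lambda>x. F x + G x) \<in> borel_measurable M" by measurable
  show "integrable M (\<lambda>x. (cmod (F x + G x))\<^sup>2)"
  proof (rule Bochner_Integration.integrable_bound)
    show "integrable M (\<lambda>x. 2 * (cmod (F x))\<^sup>2 + 2 * (cmod (G x))\<^sup>2)"
      using assms by (intro Bochner_Integration.integrable_add integrable_mult_right L2_norm_sq_integrable)
    show "AE x in M. norm ((cmod (F x + G x))\<^sup>2) \<le> norm (2 * (cmod (F x))\<^sup>2 + 2 * (cmod (G x))\<^sup>2)"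
      by (intro AE_I2) (use cmod_add_sq_le in auto)
  qed measurable
qed

lemma L2_scale [intro]: "F \<in> L2 M \<Longrightarrow> (\<lambda>x. c * F x) \<in> L2 M"
  by (auto simp: L2_def norm_mult power_mult_distrib)

lemma L2_diff [intro]:
  assumes "F \<in> L2 M" "G \<in> L2 M"
  shows "(\<lambda>x. F x - G x) \<in> L2 M"
  using L2_add[OF assms(1) L2_scale[OF assms(2), of "-1"]] by simp

lemma L2_sum [intro]: "(\<And>i. i \<in> I \<Longrightarrow> F i \<in> L2 M) \<Longrightarrow> (\<lambda>x. \<Sum>i\<in>I. F i x) \<in> L2 M"
  by (induction I rule: infinite_finite_induct) auto

lemma borel_measurable_cnj [measurable]:
  "F \<in> borel_measurable M \<Longrightarrow> (\<lambda>x. cnj (F x)) \<in> borel_measurable M"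
  by (rule borel_measurable_continuous_on[OF continuous_on_cnj[OF continuous_on_id]])

lemma L2_inner_integrable:
  assumes "F \<in> L2 M" "G \<in> L2 M"
  shows "integrable M (\<lambda>x. F x * cnj (G x))"
proof (rule Bochner_Integration.integrable_bound)
  note [measurable] = L2_measurable[OF assms(1)] L2_measurable[OF assms(2)]
  show "integrable M (\<lambda>x. (cmod (F x))\<^sup>2 + (cmod (G x))\<^sup>2)"
    using assms by (intro Bochner_Integration.integrable_add L2_norm_sq_integrable)
  show "(\<lambda>x. F x * cnj (G x)) \<in> borel_measurable M" by measurable
  have "cmod a * cmod b \<le> (cmod a)\<^sup>2 + (cmod b)\<^sup>2" for a b :: complex
  proof -
    have "2 * (cmod a * cmod b) \<le> (cmod a)\<^sup>2 + (cmod b)\<^sup>2"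
      using sum_squares_bound[of "cmod a" "cmod b"] by simp
    moreover have "0 \<le> cmod a * cmod b" by simp
    ultimately show ?thesis by linarith
  qed
  then show "AE x in M. norm (F x * cnj (G x)) \<le> norm ((cmod (F x))\<^sup>2 + (cmod (G x))\<^sup>2)"
    by (intro AE_I2) (simp add: norm_mult)
qed

lemma L2_inner_add_left:
  "F \<in> L2 M \<Longrightarrow> G \<in> L2 M \<Longrightarrow> H \<in> L2 M \<Longrightarrow>
    L2_inner M (\<lambda>x. F x + G x) H = L2_inner M F H + L2_inner M G H"
  unfolding L2_inner_def
  by (simp add: distrib_right L2_inner_integrable Bochner_Integration.integral_add)

lemma L2_inner_diff_left:
  "F \<in> L2 M \<Longrightarrow> G \<in> L2 M \<Longrightarrow> H \<in> L2 M \<Longrightarrow>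
    L2_inner M (\<lambda>x. F x - G x) H = L2_inner M F H - L2_inner M G H"
  unfolding L2_inner_def
  by (simp add: left_diff_distrib L2_inner_integrable Bochner_Integration.integral_diff)

lemma L2_inner_scale_left:
  "L2_inner M (\<lambda>x. c * F x) H = c * L2_inner M F H"
  unfolding L2_inner_def by (simp add: mult.assoc)

lemma L2_inner_cnj: "L2_inner M G F = cnj (L2_inner M F G)"
proof -
  have "(\<lambda>x. G x * cnj (F x)) = (\<lambda>x. cnj (F x * cnj (G x)))"
    by (simp add: mult.commute)
  then show ?thesis unfolding L2_inner_def by (simp only: Bochner_Integration.integral_cnj)
qed

lemma L2_inner_add_right:
  "F \<in> L2 M \<Longrightarrow> G \<in> L2 M \<Longrightarrow> H \<in> L2 M \<Longrightarrow>
    L2_inner M H (\<lambda>x. F x + G x) = L2_inner M H F + L2_inner M H G"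
  by (simp add: L2_inner_cnj[of M H] L2_inner_add_left)

lemma L2_inner_scale_right:
  "L2_inner M H (\<lambda>x. c * F x) = cnj c * L2_inner M H F"
  by (simp add: L2_inner_cnj[of M H] L2_inner_scale_left)

lemma L2_inner_cong_AE:
  assumes "F \<in> L2 M" "F' \<in> L2 M" "G \<in> L2 M" "G' \<in> L2 M"
    and "AE x in M. F x = F' x" "AE x in M. G x = G' x"
  shows "L2_inner M F G = L2_inner M F' G'"
proof -
  note [measurable] = assms(1-4)[THEN L2_measurable]
  show ?thesis
    unfolding L2_inner_def
  proof (rule integral_cong_AE)
    show "AE x in M. F x * cnj (G x) = F' x * cnj (G' x)"
      using assms(5,6) by eventually_elim simp
  qed measurable
qed

lemma L2_inner_zero_AE:
  assumes "F \<in> L2 M" "G \<in> L2 M" "AE x in M. F x = 0"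
  shows "L2_inner M F G = 0"
  using L2_inner_cong_AE[OF assms(1) L2_zero assms(2,2) assms(3)] by (simp add: L2_inner_def)

lemma L2_norm_sq: "(L2_norm M F)\<^sup>2 = (LINT x|M. (cmod (F x))\<^sup>2)"
  unfolding L2_norm_def by (simp add: integral_nonneg_AE)

lemma L2_inner_self: "L2_inner M F F = of_real ((L2_norm M F)\<^sup>2)"
  unfolding L2_norm_sq L2_inner_def complex_norm_square[symmetric]
  by (simp flip: of_real_power)

lemma L2_inner_self_eq_0_iff:
  assumes "F \<in> L2 M"
  shows "L2_inner M F F = 0 \<longleftrightarrow> (AE x in M. F x = 0)"
  unfolding L2_inner_self L2_norm_sq of_real_eq_0_iff
  by (subst integral_nonneg_eq_0_iff_AE) (use assms L2_norm_sq_integrable in auto)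

lemma L2_norm_cong_AE:
  assumes "F \<in> L2 M" "G \<in> L2 M" "AE x in M. F x = G x"
  shows "L2_norm M F = L2_norm M G"
proof -
  note [measurable] = assms(1,2)[THEN L2_measurable]
  show ?thesis
    unfolding L2_norm_def by (intro arg_cong[of _ _ sqrt] integral_cong_AE) (use assms(3) in auto)
qed

lemma L2_norm_nonneg: "0 \<le> L2_norm M F"
  unfolding L2_norm_def by (simp add: integral_nonneg_AE)

subsection \<open>Subspaces and finite generating families\<close>

lemma L2_subspaceD:
  assumes "L2_subspace M V"
  shows L2_subspace_L2: "F \<in> V \<Longrightarrow> F \<in> L2 M"
    and L2_subspace_zero: "(\<lambda>x. 0) \<in> V"
    and L2_subspace_add: "F \<in> V \<Longrightarrow> G \<in> V \<Longrightarrow> (\<lambda>x. F x + G x) \<in> V"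
    and L2_subspace_scale: "F \<in> V \<Longrightarrow> (\<lambda>x. c * F x) \<in> V"
    and L2_subspace_AE: "F \<in> V \<Longrightarrow> G \<in> L2 M \<Longrightarrow> AE x in M. F x = G x \<Longrightarrow> G \<in> V"
  using assms unfolding L2_subspace_def by blast+

lemma L2_subspace_diff:
  "L2_subspace M V \<Longrightarrow> F \<in> V \<Longrightarrow> G \<in> V \<Longrightarrow> (\<lambda>x. F x - G x) \<in> V"
  using L2_subspace_add[of M V F "\<lambda>x. -1 * G x"] L2_subspace_scale[of M V G "-1"] by simp

lemma L2_subspace_sum:
  "L2_subspace M V \<Longrightarrow> (\<And>i. i \<in> I \<Longrightarrow> F i \<in> V) \<Longrightarrow> (\<lambda>x. \<Sum>i\<in>I. F i x) \<in> V"
  by (induction I rule: infinite_finite_induct) (auto intro: L2_subspaceD)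

lemma L2_subspace_Int:
  "L2_subspace M V \<Longrightarrow> L2_subspace M W \<Longrightarrow> L2_subspace M (V \<inter> W)"
  unfolding L2_subspace_def by blast

definition L2_complement :: "'a measure \<Rightarrow> ('a \<Rightarrow> complex) set \<Rightarrow> ('a \<Rightarrow> complex) set" where
  "L2_complement M V = {F \<in> L2 M. \<forall>G\<in>V. L2_inner M F G = 0}"

lemma L2_subspace_complement:
  assumes "V \<subseteq> L2 M"
  shows "L2_subspace M (L2_complement M V)"
  unfolding L2_subspace_def
proof (intro conjI ballI allI impI)
  show "(\<lambda>x. 0) \<in> L2_complement M V"
    by (auto simp: L2_complement_def L2_inner_def)
next
  fix F G assume "F \<in> L2_complement M V" "G \<in> L2_complement M V"
  then show "(\<lambda>x. F x + G x) \<in> L2_complement M V"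
    using assms by (auto simp: L2_complement_def L2_inner_add_left subset_iff)
next
  fix F G assume "F \<in> L2_complement M V" "G \<in> L2 M" "AE x in M. F x = G x"
  then show "G \<in> L2_complement M V"
    using assms L2_inner_cong_AE[of F M G] by (fastforce simp: L2_complement_def subset_iff)
qed (auto simp: L2_complement_def L2_inner_scale_left)

definition L2_span :: "'a measure \<Rightarrow> (nat \<Rightarrow> 'a \<Rightarrow> complex) \<Rightarrow> nat \<Rightarrow> ('a \<Rightarrow> complex) set" where
  "L2_span M b k = {F \<in> L2 M. \<exists>c. AE x in M. F x = (\<Sum>i<k. c i * b i x)}"

lemma L2_spanI: "F \<in> L2 M \<Longrightarrow> AE x in M. F x = (\<Sum>i<k. c i * b i x) \<Longrightarrow> F \<in> L2_span M b k"
  unfolding L2_span_def by blast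

lemma L2_spanE:
  assumes "F \<in> L2_span M b k"
  obtains c where "AE x in M. F x = (\<Sum>i<k. c i * b i x)"
  using assms unfolding L2_span_def by blast

lemma L2_subspace_span: "L2_subspace M (L2_span M b k)"
  unfolding L2_subspace_def
proof (intro conjI ballI allI impI)
  show "L2_span M b k \<subseteq> L2 M" by (auto simp: L2_span_def)
  show "(\<lambda>x. 0) \<in> L2_span M b k"
    by (rule L2_spanI[where c = "\<lambda>_. 0"]) auto
next
  fix F G assume F: "F \<in> L2_span M b k" and G: "G \<in> L2_span M b k"
  obtain c d where cd: "AE x in M. F x = (\<Sum>i<k. c i * b i x)" "AE x in M. G x = (\<Sum>i<k. d i * b i x)"
    using F G by (auto elim!: L2_spanE)
  show "(\<lambda>x. F x + G x) \<in> L2_span M b k"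
  proof (rule L2_spanI[where c = "\<lambda>i. c i + d i"])
    show "AE x in M. F x + G x = (\<Sum>i<k. (c i + d i) * b i x)"
      using cd by eventually_elim (simp add: distrib_right sum.distrib)
  qed (use F G in \<open>auto simp: L2_span_def\<close>)
next
  fix a F assume F: "F \<in> L2_span M b k"
  obtain c where c: "AE x in M. F x = (\<Sum>i<k. c i * b i x)"
    using F by (auto elim!: L2_spanE)
  show "(\<lambda>x. a * F x) \<in> L2_span M b k"
  proof (rule L2_spanI[where c = "\<lambda>i. a * c i"])
    show "AE x in M. a * F x = (\<Sum>i<k. a * c i * b i x)"
      using c by eventually_elim (simp add: sum_distrib_left mult.assoc)
  qed (use F in \<open>auto simp: L2_span_def\<close>)
next
  fix F G assume F: "F \<in> L2_span M b k" and G: "G \<in> L2 M" and FG: "AE x in M. F x = G x"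
  obtain c where c: "AE x in M. F x = (\<Sum>i<k. c i * b i x)"
    using F by (auto elim!: L2_spanE)
  show "G \<in> L2_span M b k"
  proof (rule L2_spanI[where c = c, OF G])
    show "AE x in M. G x = (\<Sum>i<k. c i * b i x)"
      using c FG by eventually_elim simp
  qed
qed

lemma L2_span_mono: "j \<le> k \<Longrightarrow> L2_span M b j \<subseteq> L2_span M b k"
proof
  fix F assume jk: "j \<le> k" and F: "F \<in> L2_span M b j"
  obtain c where c: "AE x in M. F x = (\<Sum>i<j. c i * b i x)"
    using F by (auto elim!: L2_spanE)
  show "F \<in> L2_span M b k"
  proof (rule L2_spanI[where c = "\<lambda>i. if i < j then c i else 0"])
    show "F \<in> L2 M" using F by (simp add: L2_span_def)
    have "(\<Sum>i<k. (if i < j then c i else 0) * b i x) = (\<Sum>i<j. c i * b i x)" for x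
      using jk by (intro sum.mono_neutral_cong_right) auto
    then show "AE x in M. F x = (\<Sum>i<k. (if i < j then c i else 0) * b i x)"
      using c by simp
  qed
qed

lemma L2_span_base: "i < k \<Longrightarrow> b i \<in> L2 M \<Longrightarrow> b i \<in> L2_span M b k"
proof (rule L2_spanI[where c = "\<lambda>j. if j = i then 1 else 0"])
  assume "i < k"
  then have "(\<Sum>j<k. (if j = i then 1 else 0) * b j x) = b i x" for x
    by (subst sum.remove[of _ i]) (auto intro!: sum.neutral)
  then show "AE x in M. b i x = (\<Sum>j<k. (if j = i then 1 else 0) * b j x)" by simp
qed

lemma L2_span_least:
  assumes "L2_subspace M V" "\<And>i. i < k \<Longrightarrow> b i \<in> V"
  shows "L2_span M b k \<subseteq> V"
proof
  fix F assume F: "F \<in> L2_span M b k"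
  obtain c where c: "AE x in M. F x = (\<Sum>i<k. c i * b i x)"
    using F by (auto elim!: L2_spanE)
  have "(\<lambda>x. \<Sum>i<k. c i * b i x) \<in> V"
    using assms by (intro L2_subspace_sum L2_subspace_scale) auto
  then show "F \<in> V"
    using L2_subspace_AE[OF assms(1), of _ F] c F by (auto simp: L2_span_def eq_commute)
qed

definition L2_generated :: "'a measure \<Rightarrow> ('a \<Rightarrow> complex) set \<Rightarrow> nat \<Rightarrow> bool" where
  "L2_generated M V k \<longleftrightarrow> (\<exists>b. (\<forall>i<k. b i \<in> V) \<and> V \<subseteq> L2_span M b k)"

lemma L2_generated_eq_span:
  assumes "L2_subspace M V" "L2_generated M V k"
  obtains b where "\<And>i. i < k \<Longrightarrow> b i \<in> L2 M" "V = L2_span M b k"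
proof -
  obtain b where b: "\<forall>i<k. b i \<in> V" "V \<subseteq> L2_span M b k"
    using assms(2) unfolding L2_generated_def by blast
  show thesis
    using that[of b] b L2_span_least[OF assms(1), of k b] L2_subspace_L2[OF assms(1)] by blast
qed

lemma L2_finite_dim_if_generated:
  assumes "L2_generated M V k"
  shows "L2_finite_dim M V"
proof -
  obtain b where b: "\<forall>i<k. b i \<in> V" "V \<subseteq> L2_span M b k"
    using assms unfolding L2_generated_def by blast
  show ?thesis
    unfolding L2_finite_dim_def
  proof (intro exI[of _ "b ` {..<k}"] conjI ballI)
    show "finite (b ` {..<k})" "b ` {..<k} \<subseteq> V" using b(1) by auto
    fix F assume "F \<in> V"
    with b(2) obtain c where c: "AE x in M. F x = (\<Sum>i<k. c i * b i x)"
      by (auto elim!: L2_spanE)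
    have "(\<Sum>i<k. c i * b i x) = (\<Sum>g\<in>b ` {..<k}. (\<Sum>i\<in>{i\<in>{..<k}. b i = g}. c i) * g x)" for x
      by (simp add: sum.image_gen[of "{..<k}" "\<lambda>i. c i * b i x" b] sum_distrib_right)
    then show "\<exists>d. AE x in M. F x = (\<Sum>g\<in>b ` {..<k}. d g * g x)"
      using c by (intro exI[of _ "\<lambda>g. (\<Sum>i\<in>{i\<in>{..<k}. b i = g}. c i)"]) simp
  qed
qed

text \<open>Dimension is replaced throughout by the size of a generating family. A proper subspace needs
  fewer generators: peel off the last generator, and use an element of the subspace whose last
  coefficient does not vanish to reduce every other element to the span of the earlier ones.\<close>

lemma L2_proper_subspace_of_span:
  assumes "\<And>i. i < k \<Longrightarrow> b i \<in> L2 M"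
    and "L2_subspace M W" "W \<subseteq> L2_span M b k" "W \<noteq> L2_span M b k"
  shows "\<exists>j<k. L2_generated M W j"
  using assms
proof (induction k arbitrary: W)
  case 0
  have "L2_span M b 0 \<subseteq> W" by (rule L2_span_least) (use 0 in auto)
  with 0 show ?case by blast
next
  case (Suc k)
  let ?S = "L2_span M b k"
  have sub: "L2_subspace M (W \<inter> ?S)"
    by (intro L2_subspace_Int Suc.prems L2_subspace_span)
  show ?case
  proof (cases "W \<subseteq> ?S")
    case True
    show ?thesis
    proof (cases "W = ?S")
      case True
      then have "L2_generated M W k"
        unfolding L2_generated_def using Suc.prems(1)
        by (intro exI[of _ b]) (auto intro: L2_span_base)
      then show ?thesis by blast
    next
      case False
      then show ?thesis
        using Suc.IH[of W] Suc.prems True by (auto intro: less_SucI)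
    qed
  next
    case False
    then obtain u where u: "u \<in> W" "u \<notin> ?S" by blast
    with Suc.prems(3) obtain c where c: "AE x in M. u x = (\<Sum>i<Suc k. c i * b i x)"
      by (auto elim!: L2_spanE)
    have uL2: "u \<in> L2 M" using u Suc.prems(2) by (auto intro: L2_subspaceD)
    have ck: "c k \<noteq> 0"
    proof
      assume "c k = 0"
      then have "u \<in> ?S" using c uL2 by (intro L2_spanI[where c = c]) auto
      with u show False by blast
    qed
    have reduce: "\<exists>e. (\<lambda>x. F x - e * u x) \<in> W \<inter> ?S" if F: "F \<in> W" for F
    proof -
      have FL2: "F \<in> L2 M" using F Suc.prems(2) by (auto intro: L2_subspaceD)
      obtain d where d: "AE x in M. F x = (\<Sum>i<Suc k. d i * b i x)"
        using F Suc.prems(3) by (blast elim: L2_spanE)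
      let ?e = "d k / c k"
      have "(\<lambda>x. F x - ?e * u x) \<in> ?S"
      proof (rule L2_spanI[where c = "\<lambda>i. d i - ?e * c i"])
        show "AE x in M. F x - ?e * u x = (\<Sum>i<k. (d i - ?e * c i) * b i x)"
          using c d
        proof eventually_elim
          case (elim x)
          have "F x - ?e * u x = (\<Sum>i<k. d i * b i x) - ?e * (\<Sum>i<k. c i * b i x)"
            using ck by (simp add: elim distrib_left)
          then show ?case by (simp add: left_diff_distrib sum_subtractf sum_distrib_left mult.assoc)
        qed
      qed (rule L2_diff[OF FL2 L2_scale[OF uL2]])
      moreover have "(\<lambda>x. F x - ?e * u x) \<in> W"
        using that u by (intro L2_subspace_diff[OF Suc.prems(2)] L2_subspace_scale[OF Suc.prems(2)])
      ultimately show ?thesis by blast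
    qed
    show ?thesis
    proof (cases "W \<inter> ?S = ?S")
      case True
      have "b k \<in> W"
      proof -
        have "(\<lambda>x. b k x - (1 / c k) * u x) \<in> ?S"
        proof (rule L2_spanI[where c = "\<lambda>i. - c i / c k"])
          show "AE x in M. b k x - (1 / c k) * u x = (\<Sum>i<k. (- c i / c k) * b i x)"
            using c
          proof eventually_elim
            case (elim x)
            have "b k x - (1 / c k) * u x = - (1 / c k) * (\<Sum>i<k. c i * b i x)"
              using ck by (simp add: elim field_simps)
            then show ?case by (simp add: sum_distrib_left sum_negf field_simps)
          qed
        qed (rule L2_diff[OF Suc.prems(1)[OF lessI] L2_scale[OF uL2]])
        then have "(\<lambda>x. (b k x - (1 / c k) * u x) + (1 / c k) * u x) \<in> W"
          using True u by (intro L2_subspace_add[OF Suc.prems(2)] L2_subspace_scale[OF Suc.prems(2)]) auto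
        then show ?thesis by simp
      qed
      moreover have "b i \<in> W" if "i < k" for i
        using True L2_span_base[OF that, of b M] Suc.prems(1)[of i] that by auto
      ultimately have "L2_span M b (Suc k) \<subseteq> W"
        by (intro L2_span_least Suc.prems) (auto simp: less_Suc_eq)
      with Suc.prems show ?thesis by blast
    next
      case False
      then obtain j where j: "j < k" "L2_generated M (W \<inter> ?S) j"
        using Suc.IH[OF _ sub] Suc.prems(1) by auto
      obtain b' where b': "\<forall>i<j. b' i \<in> W \<inter> ?S" "W \<inter> ?S \<subseteq> L2_span M b' j"
        using j(2) unfolding L2_generated_def by blast
      let ?b = "b'(j := u)"
      have "W \<subseteq> L2_span M ?b (Suc j)"
      proof
        fix F assume F: "F \<in> W"
        obtain e where "(\<lambda>x. F x - e * u x) \<in> L2_span M b' j"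
          using reduce[OF F] b'(2) by blast
        then obtain d where d: "AE x in M. F x - e * u x = (\<Sum>i<j. d i * b' i x)"
          by (auto elim!: L2_spanE)
        show "F \<in> L2_span M ?b (Suc j)"
        proof (rule L2_spanI[where c = "d(j := e)"])
          show "AE x in M. F x = (\<Sum>i<Suc j. (d(j := e)) i * ?b i x)"
            using d by eventually_elim (simp add: diff_eq_eq)
        qed (use F Suc.prems(2) in \<open>auto intro: L2_subspaceD\<close>)
      qed
      moreover have "\<forall>i<Suc j. ?b i \<in> W" using b'(1) u by (auto simp: less_Suc_eq)
      ultimately have "L2_generated M W (Suc j)" unfolding L2_generated_def by blast
      with j(1) show ?thesis by blast
    qed
  qed
qed

corollary L2_proper_subspace_generated:
  assumes "L2_subspace M V" "L2_generated M V k" "L2_subspace M W" "W \<subseteq> V" "W \<noteq> V"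
  shows "\<exists>j<k. L2_generated M W j"
  using L2_generated_eq_span[OF assms(1,2)] L2_proper_subspace_of_span[of k _ M W] assms(3-5)
  by metis

text \<open>Gram--Schmidt: orthogonal projections onto finitely generated subspaces exist. In the step,
  \<open>r\<close> is the component of the new generator orthogonal to the earlier ones; if it vanishes almost
  everywhere, then \<open>t = 0\<close> by the convention for division by zero, as it should be.\<close>

lemma L2_projection_span:
  assumes "\<And>i. i < k \<Longrightarrow> b i \<in> L2 M" "F \<in> L2 M"
  shows "\<exists>G \<in> L2_span M b k. (\<lambda>x. F x - G x) \<in> L2_complement M (L2_span M b k)"
  using assms
proof (induction k arbitrary: F)
  case 0
  have "L2_inner M F H = 0" if H: "H \<in> L2_span M b 0" for H
  proof -
    have "AE x in M. H x = 0" "H \<in> L2 M" using H by (auto simp: L2_span_def)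
    then have "L2_inner M H F = 0" using 0 by (intro L2_inner_zero_AE) auto
    then show ?thesis by (simp add: L2_inner_cnj[of M F H])
  qed
  then show ?case
    using 0 by (intro bexI[of _ "\<lambda>x. 0"]) (auto simp: L2_complement_def intro: L2_subspaceD[OF L2_subspace_span])
next
  case (Suc k)
  let ?S = "L2_span M b k" and ?S' = "L2_span M b (Suc k)"
  have bk: "b k \<in> L2 M" using Suc.prems by auto
  obtain g where g: "g \<in> ?S" "(\<lambda>x. b k x - g x) \<in> L2_complement M ?S"
    using Suc.IH[OF _ bk] Suc.prems by auto
  obtain G0 where G0: "G0 \<in> ?S" "(\<lambda>x. F x - G0 x) \<in> L2_complement M ?S"
    using Suc.IH[of F] Suc.prems by auto
  have L2: "g \<in> L2 M" "G0 \<in> L2 M" using g G0 by (auto simp: L2_span_def)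
  define r where "r = (\<lambda>x. b k x - g x)"
  have r: "r \<in> L2 M" "\<And>H. H \<in> ?S \<Longrightarrow> L2_inner M r H = 0"
    using g(2) by (auto simp: r_def L2_complement_def)
  have r': "L2_inner M H r = 0" if "H \<in> ?S" for H
    using r(2)[OF that] by (simp add: L2_inner_cnj[of M H r])
  define t where "t = L2_inner M F r / L2_inner M r r"
  have t: "t * L2_inner M r r = L2_inner M F r"
  proof (cases "L2_inner M r r = 0")
    case True
    then have "L2_inner M r F = 0"
      using L2_inner_zero_AE[of r M F] L2_inner_self_eq_0_iff[of r M] r Suc.prems by auto
    then show ?thesis by (simp add: True L2_inner_cnj[of M F r])
  qed (simp add: t_def)
  define G where "G = (\<lambda>x. G0 x + t * r x)"
  have GL2: "G \<in> L2 M" using r L2 by (auto simp: G_def)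
  have S_sub: "?S \<subseteq> ?S'" by (rule L2_span_mono) simp
  have "b k \<in> ?S'" by (rule L2_span_base) (use bk in auto)
  then have "r \<in> ?S'"
    unfolding r_def using g(1) S_sub by (intro L2_subspace_diff[OF L2_subspace_span]) auto
  then have "G \<in> ?S'"
    unfolding G_def using G0(1) S_sub
    by (intro L2_subspace_add[OF L2_subspace_span] L2_subspace_scale[OF L2_subspace_span]) auto
  moreover have "L2_inner M (\<lambda>x. F x - G x) H = 0" if H: "H \<in> ?S'" for H
  proof -
    obtain c where c: "AE x in M. H x = (\<Sum>i<Suc k. c i * b i x)"
      using H by (auto elim!: L2_spanE)
    have HL2: "H \<in> L2 M" using H by (simp add: L2_span_def)
    define H1 where "H1 = (\<lambda>x. H x - c k * r x)"
    have H1: "H1 \<in> ?S"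
    proof -
      have "(\<lambda>x. H x - c k * b k x) \<in> ?S"
      proof (rule L2_spanI[where c = c])
        show "AE x in M. H x - c k * b k x = (\<Sum>i<k. c i * b i x)"
          using c by eventually_elim simp
      qed (use HL2 bk in auto)
      then have "(\<lambda>x. (H x - c k * b k x) + c k * g x) \<in> ?S"
        using g(1) by (intro L2_subspace_add[OF L2_subspace_span] L2_subspace_scale[OF L2_subspace_span])
      then show ?thesis by (simp add: H1_def r_def algebra_simps)
    qed
    have H1L2: "H1 \<in> L2 M" using HL2 r by (auto simp: H1_def)
    have FG: "L2_inner M (\<lambda>x. F x - G x) K = L2_inner M (\<lambda>x. F x - G0 x) K - t * L2_inner M r K"
      if "K \<in> L2 M" for K
    proof -
      have "(\<lambda>x. F x - G x) = (\<lambda>x. (F x - G0 x) - t * r x)" by (auto simp: G_def)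
      then show ?thesis
        using that r L2 Suc.prems
        by (simp add: L2_inner_diff_left[of "\<lambda>x. F x - G0 x" M "\<lambda>x. t * r x"] L2_inner_scale_left L2_diff L2_scale)
    qed
    have "L2_inner M (\<lambda>x. F x - G x) r = 0"
      using FG[OF r(1)] L2_inner_diff_left[of F M G0 r] r r'[OF G0(1)] Suc.prems L2 t by simp
    moreover have "L2_inner M (\<lambda>x. F x - G x) H1 = 0"
      using FG[OF H1L2] r(2)[OF H1] G0(2) H1 by (simp add: L2_complement_def)
    moreover have "H = (\<lambda>x. H1 x + c k * r x)" by (auto simp: H1_def)
    ultimately show ?thesis
      using L2_inner_add_right[of H1 M "\<lambda>x. c k * r x" "\<lambda>x. F x - G x"] r H1L2 Suc.prems GL2
      by (simp add: L2_inner_scale_right L2_diff L2_scale)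
  qed
  ultimately show ?case
    using Suc.prems GL2 by (intro bexI[of _ G]) (auto simp: L2_complement_def)
qed

lemma L2_projection:
  assumes "L2_subspace M V" "L2_generated M V k" "F \<in> L2 M"
  obtains G where "G \<in> V" "(\<lambda>x. F x - G x) \<in> L2_complement M V"
  using L2_generated_eq_span[OF assms(1,2)] L2_projection_span[OF _ assms(3)] by metis

lemma L2_trivial_if_self_orthogonal:
  assumes "L2_subspace M V" "V \<subseteq> L2_complement M V"
  shows "L2_trivial M V"
  using assms L2_inner_self_eq_0_iff unfolding L2_trivial_def L2_complement_def by blast

lemma L2_complement_antimono: "V \<subseteq> W \<Longrightarrow> L2_complement M W \<subseteq> L2_complement M V"
  unfolding L2_complement_def by blast

lemma L2_complement_sym:
  "V \<subseteq> L2 M \<Longrightarrow> W \<subseteq> L2_complement M V \<Longrightarrow> V \<subseteq> L2_complement M W"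
  unfolding L2_complement_def
  by (smt (verit, ccfv_threshold) L2_inner_cnj complex_cnj_zero mem_Collect_eq subset_iff)

section \<open>Orthogonal decompositions into irreducible subrepresentations\<close>

text \<open>For a family of subspaces, this is the linear span of their union.\<close>

definition L2_sums :: "'a measure \<Rightarrow> ('a \<Rightarrow> complex) set set \<Rightarrow> ('a \<Rightarrow> complex) set" where
  "L2_sums M \<V> = {F. \<exists>\<W> G. finite \<W> \<and> \<W> \<subseteq> \<V> \<and> (\<forall>V\<in>\<W>. G V \<in> V) \<and>
     (AE x in M. F x = (\<Sum>V\<in>\<W>. G V x))}"

lemma L2_sums_mono: "\<V> \<subseteq> \<V>' \<Longrightarrow> L2_sums M \<V> \<subseteq> L2_sums M \<V>'"
  unfolding L2_sums_def by blast

lemma L2_sums_base: "V \<in> \<V> \<Longrightarrow> V \<subseteq> L2_sums M \<V>"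
  unfolding L2_sums_def
  by (auto intro!: exI[of _ "{V}"] exI[of _ "\<lambda>_. x" for x])

lemma L2_sums_add:
  assumes sub: "\<And>V. V \<in> \<V> \<Longrightarrow> L2_subspace M V"
    and F: "F \<in> L2_sums M \<V>" and F': "F' \<in> L2_sums M \<V>"
  shows "(\<lambda>x. F x + F' x) \<in> L2_sums M \<V>"
proof -
  obtain \<W> G where W: "finite \<W>" "\<W> \<subseteq> \<V>" "\<forall>V\<in>\<W>. G V \<in> V" "AE x in M. F x = (\<Sum>V\<in>\<W>. G V x)"
    using F unfolding L2_sums_def by blast
  obtain \<W>' G' where W': "finite \<W>'" "\<W>' \<subseteq> \<V>" "\<forall>V\<in>\<W>'. G' V \<in> V"
    "AE x in M. F' x = (\<Sum>V\<in>\<W>'. G' V x)"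
    using F' unfolding L2_sums_def by blast
  let ?ext = "\<lambda>\<W> G V. if V \<in> \<W> then G V else (\<lambda>x. 0 :: complex)"
  let ?H = "\<lambda>V x. ?ext \<W> G V x + ?ext \<W>' G' V x"
  have ext: "?ext \<W>0 G0 V \<in> V" if "V \<in> \<V>" "\<forall>V\<in>\<W>0. G0 V \<in> V" for \<W>0 G0 V
    using that L2_subspace_zero[OF sub] by auto
  have sums: "(\<Sum>V\<in>\<W>\<union>\<W>'. ?ext \<W> G V x) = (\<Sum>V\<in>\<W>. G V x)"
    "(\<Sum>V\<in>\<W>\<union>\<W>'. ?ext \<W>' G' V x) = (\<Sum>V\<in>\<W>'. G' V x)" for x
    using W(1) W'(1) by (intro sum.mono_neutral_cong_right; auto)+
  have "AE x in M. F x + F' x = (\<Sum>V\<in>\<W>\<union>\<W>'. ?H V x)"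
    using W(4) W'(4) by eventually_elim (simp only: sum.distrib sums)
  moreover have "\<forall>V\<in>\<W>\<union>\<W>'. ?H V \<in> V"
    using ext[of _ \<W> G] ext[of _ \<W>' G'] W(2,3) W'(2,3) by (auto intro!: L2_subspace_add[OF sub])
  ultimately show ?thesis
    unfolding L2_sums_def using W W' by (auto intro!: exI[of _ "\<W> \<union> \<W>'"] exI[of _ ?H])
qed

text \<open>Decomposition rests on the fact that the adjoint of an operator of a unitary representation is
  again one of its operators; this makes complements of invariant subspaces invariant.\<close>

locale L2_representation =
  fixes M :: "'a measure" and U :: "'h \<Rightarrow> ('a \<Rightarrow> complex) \<Rightarrow> 'a \<Rightarrow> complex" and adj :: "'h \<Rightarrow> 'h"
  assumes U_L2: "F \<in> L2 M \<Longrightarrow> U h F \<in> L2 M"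
    and U_adjoint: "F \<in> L2 M \<Longrightarrow> G \<in> L2 M \<Longrightarrow> L2_inner M (U h F) G = L2_inner M F (U (adj h) G)"
begin

lemma invariant_complement:
  assumes "V \<subseteq> L2 M" "L2_invariant U V"
  shows "L2_invariant U (L2_complement M V)"
  unfolding L2_invariant_def
proof (intro allI ballI)
  fix h F assume F: "F \<in> L2_complement M V"
  then have FL2: "F \<in> L2 M" by (simp add: L2_complement_def)
  have "L2_inner M (U h F) G = 0" if "G \<in> V" for G
    using that F assms U_adjoint[OF FL2, of G h] by (auto simp: L2_complement_def L2_invariant_def)
  then show "U h F \<in> L2_complement M V" using U_L2[OF FL2] by (simp add: L2_complement_def)
qed

lemma invariant_Int: "L2_invariant U V \<Longrightarrow> L2_invariant U W \<Longrightarrow> L2_invariant U (V \<inter> W)"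
  unfolding L2_invariant_def by blast

text \<open>The algebraic counterpart of \<^const>\<open>L2_decomposition\<close>: sums are finite and exact, so
  that it can be built up along an increasing sequence of subspaces.\<close>

definition decomposes :: "('a \<Rightarrow> complex) set set \<Rightarrow> ('a \<Rightarrow> complex) set \<Rightarrow> bool" where
  "decomposes \<D> V \<longleftrightarrow>
     (\<forall>W\<in>\<D>. L2_finite_dim M W \<and> L2_irreducible M U W \<and> W \<subseteq> V) \<and>
     (\<forall>W\<in>\<D>. \<forall>W'\<in>\<D>. W \<noteq> W' \<longrightarrow> W \<subseteq> L2_complement M W') \<and>
     V \<subseteq> L2_sums M \<D>"

lemma decomposesD:
  assumes "decomposes \<D> V"
  shows decomposes_summand: "W \<in> \<D> \<Longrightarrow> L2_finite_dim M W \<and> L2_irreducible M U W \<and> W \<subseteq> V"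
    and decomposes_orthogonal: "W \<in> \<D> \<Longrightarrow> W' \<in> \<D> \<Longrightarrow> W \<noteq> W' \<Longrightarrow> W \<subseteq> L2_complement M W'"
    and decomposes_sums: "V \<subseteq> L2_sums M \<D>"
  using assms unfolding decomposes_def by (elim conjE; simp)+

lemma decomposes_subspace: "decomposes \<D> V \<Longrightarrow> W \<in> \<D> \<Longrightarrow> L2_subspace M W"
  unfolding decomposes_def L2_irreducible_def by blast

lemma decomposes_orthogonal_sum:
  assumes D1: "decomposes \<D>\<^sub>1 V\<^sub>1" and D2: "decomposes \<D>\<^sub>2 V\<^sub>2"
    and "V\<^sub>1 \<subseteq> V" "V\<^sub>2 \<subseteq> V" "V\<^sub>1 \<subseteq> L2 M" "V\<^sub>2 \<subseteq> L2_complement M V\<^sub>1"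
    and split: "\<And>F. F \<in> V \<Longrightarrow> \<exists>G\<in>V\<^sub>1. (\<lambda>x. F x - G x) \<in> V\<^sub>2"
  shows "decomposes (\<D>\<^sub>1 \<union> \<D>\<^sub>2) V"
proof -
  have V1: "V\<^sub>1 \<subseteq> L2_complement M V\<^sub>2"
    by (rule L2_complement_sym) (use assms in auto)
  have orth: "W \<subseteq> L2_complement M W'" "W' \<subseteq> L2_complement M W" if "W \<in> \<D>\<^sub>1" "W' \<in> \<D>\<^sub>2" for W W'
  proof -
    have "W \<subseteq> V\<^sub>1" "W' \<subseteq> V\<^sub>2"
      using decomposes_summand[OF D1] decomposes_summand[OF D2] that by auto
    then show "W \<subseteq> L2_complement M W'" "W' \<subseteq> L2_complement M W"
      using V1 assms(6) L2_complement_antimono[of W V\<^sub>1 M] L2_complement_antimono[of W' V\<^sub>2 M] by auto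
  qed
  have sub: "L2_subspace M W" if "W \<in> \<D>\<^sub>1 \<union> \<D>\<^sub>2" for W
    using that decomposes_subspace D1 D2 by blast
  have "F \<in> L2_sums M (\<D>\<^sub>1 \<union> \<D>\<^sub>2)" if F: "F \<in> V" for F
  proof -
    obtain G where G: "G \<in> V\<^sub>1" "(\<lambda>x. F x - G x) \<in> V\<^sub>2" using split[OF F] by blast
    have "G \<in> L2_sums M (\<D>\<^sub>1 \<union> \<D>\<^sub>2)" "(\<lambda>x. F x - G x) \<in> L2_sums M (\<D>\<^sub>1 \<union> \<D>\<^sub>2)"
      using G decomposes_sums[OF D1] decomposes_sums[OF D2] L2_sums_mono[of \<D>\<^sub>1 "\<D>\<^sub>1 \<union> \<D>\<^sub>2" M]
        L2_sums_mono[of \<D>\<^sub>2 "\<D>\<^sub>1 \<union> \<D>\<^sub>2" M] by auto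
    from L2_sums_add[OF sub this] show ?thesis by simp
  qed
  then have "V \<subseteq> L2_sums M (\<D>\<^sub>1 \<union> \<D>\<^sub>2)" by blast
  moreover have "W \<subseteq> L2_complement M W'"
    if "W \<in> \<D>\<^sub>1 \<union> \<D>\<^sub>2" "W' \<in> \<D>\<^sub>1 \<union> \<D>\<^sub>2" "W \<noteq> W'" for W W'
    using that orth decomposes_orthogonal[OF D1] decomposes_orthogonal[OF D2] by (elim UnE) auto
  moreover have "L2_finite_dim M W \<and> L2_irreducible M U W \<and> W \<subseteq> V"
    if "W \<in> \<D>\<^sub>1 \<union> \<D>\<^sub>2" for W
    using that
  proof
    assume "W \<in> \<D>\<^sub>1"
    then show ?thesis using decomposes_summand[OF D1, of W] assms(3) by auto
  next
    assume "W \<in> \<D>\<^sub>2"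
    then show ?thesis using decomposes_summand[OF D2, of W] assms(4) by auto
  qed
  ultimately show ?thesis unfolding decomposes_def by simp
qed

text \<open>Split off an invariant subspace and its orthogonal complement; both are proper, hence need
  fewer generators.\<close>

lemma decomposition_exists:
  assumes "L2_subspace M V" "L2_invariant U V" "L2_generated M V k"
  shows "\<exists>\<D>. decomposes \<D> V"
  using assms
proof (induction k arbitrary: V rule: less_induct)
  case (less k)
  consider "L2_trivial M V" | "L2_irreducible M U V"
    | W where "L2_subspace M W" "L2_invariant U W" "W \<subseteq> V" "\<not> L2_trivial M W" "W \<noteq> V"
    using less.prems unfolding L2_irreducible_def by blast
  then show ?case
  proof cases
    case 1
    then have "decomposes {} V"
      unfolding decomposes_def L2_sums_def L2_trivial_def by auto
    then show ?thesis by blast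
  next
    case 2
    then have "decomposes {V} V"
      unfolding decomposes_def
      using L2_finite_dim_if_generated[OF less.prems(3)] L2_sums_base[of V "{V}" M] by auto
    then show ?thesis by blast
  next
    case 3
    have WL2: "W \<subseteq> L2 M" using 3(1) by (auto intro: L2_subspaceD)
    let ?W' = "V \<inter> L2_complement M W"
    have W': "L2_subspace M ?W'" "L2_invariant U ?W'"
      using L2_subspace_Int[OF less.prems(1) L2_subspace_complement[OF WL2]]
        invariant_Int[OF less.prems(2) invariant_complement[OF WL2 3(2)]] by auto
    have "?W' \<noteq> V"
    proof
      assume "?W' = V"
      then have "W \<subseteq> L2_complement M W" using 3(3) by blast
      then show False using L2_trivial_if_self_orthogonal 3 by blast
    qed
    then obtain j' where j': "j' < k" "L2_generated M ?W' j'"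
      using L2_proper_subspace_generated[OF less.prems(1,3) W'(1)] by blast
    obtain j where j: "j < k" "L2_generated M W j"
      using L2_proper_subspace_generated[OF less.prems(1,3) 3(1)] 3 by blast
    obtain \<D>\<^sub>1 \<D>\<^sub>2 where D: "decomposes \<D>\<^sub>1 W" "decomposes \<D>\<^sub>2 ?W'"
      using less.IH[OF j(1) 3(1,2) j(2)] less.IH[OF j'(1) W' j'(2)] by blast
    have "decomposes (\<D>\<^sub>1 \<union> \<D>\<^sub>2) V"
    proof (rule decomposes_orthogonal_sum[OF D 3(3) _ WL2])
      fix F assume F: "F \<in> V"
      then obtain G where "G \<in> W" "(\<lambda>x. F x - G x) \<in> L2_complement M W"
        using L2_projection[OF 3(1) j(2)] less.prems(1) L2_subspace_L2 by metis
      then show "\<exists>G\<in>W. (\<lambda>x. F x - G x) \<in> ?W'"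
        using F 3(3) L2_subspace_diff[OF less.prems(1)] by blast
    qed auto
    then show ?thesis by blast
  qed
qed

end

locale L2_exhausted_representation = L2_representation +
  fixes E :: "nat \<Rightarrow> ('a \<Rightarrow> complex) set"
  assumes E_subspace: "L2_subspace M (E n)"
    and E_invariant: "L2_invariant U (E n)"
    and E_generated: "\<exists>k. L2_generated M (E n) k"
    and E_mono: "i \<le> j \<Longrightarrow> E i \<subseteq> E j"
    and E_dense: "F \<in> L2 M \<Longrightarrow> 0 < \<epsilon> \<Longrightarrow> \<exists>n. \<exists>G\<in>E n. L2_norm M (\<lambda>x. F x - G x) < \<epsilon>"
begin

lemma E_L2: "E n \<subseteq> L2 M"
  using E_subspace by (auto intro: L2_subspaceD)

text \<open>Decompose the first space, and then the orthogonal complement of each space in the next.\<close>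

lemma decomposition_from_first:
  assumes D0: "decomposes \<D>\<^sub>0 (E 0)"
  shows "\<exists>\<V>. \<D>\<^sub>0 \<subseteq> \<V> \<and> L2_decomposition M U \<V>"
proof -
  define R where "R n = E (Suc n) \<inter> L2_complement M (E n)" for n
  have R: "L2_subspace M (R n)" "L2_invariant U (R n)" for n
    unfolding R_def
    using L2_subspace_Int[OF E_subspace L2_subspace_complement[OF E_L2]]
      invariant_Int[OF E_invariant invariant_complement[OF E_L2 E_invariant]] by auto
  have "\<exists>k. L2_generated M (R n) k" for n
    using E_generated[of "Suc n"] L2_proper_subspace_generated[OF E_subspace[of "Suc n"] _ R(1)[of n]]
    by (cases "R n = E (Suc n)") (auto simp: R_def)
  then have "\<exists>\<D>. decomposes \<D> (R n)" for n
    using decomposition_exists R by blast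
  then obtain D where D: "\<And>n. decomposes (D n) (R n)" by metis
  define C where "C n = \<D>\<^sub>0 \<union> (\<Union>i<n. D i)" for n
  have C: "decomposes (C n) (E n)" for n
  proof (induction n)
    case 0
    then show ?case using D0 by (simp add: C_def)
  next
    case (Suc n)
    have "decomposes (C n \<union> D n) (E (Suc n))"
    proof (rule decomposes_orthogonal_sum[OF Suc D])
      fix F assume F: "F \<in> E (Suc n)"
      then obtain G where G: "G \<in> E n" "(\<lambda>x. F x - G x) \<in> L2_complement M (E n)"
        using L2_projection[OF E_subspace[of n]] E_generated[of n] E_L2 by (metis subsetD)
      moreover have "(\<lambda>x. F x - G x) \<in> E (Suc n)"
        using F G E_mono[of n "Suc n"] by (intro L2_subspace_diff[OF E_subspace]) auto
      ultimately show "\<exists>G\<in>E n. (\<lambda>x. F x - G x) \<in> R n" unfolding R_def by blast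
    qed (use E_mono[of n "Suc n"] E_L2 in \<open>auto simp: R_def\<close>)
    moreover have "C n \<union> D n = C (Suc n)" by (auto simp: C_def less_Suc_eq)
    ultimately show ?case by simp
  qed
  define \<V> where "\<V> = (\<Union>n. C n)"
  have mono: "C i \<subseteq> C j" if "i \<le> j" for i j using that by (force simp: C_def)
  have "L2_decomposition M U \<V>"
    unfolding L2_decomposition_def
  proof (intro conjI ballI allI impI)
    fix V W F G assume "V \<in> \<V>" "W \<in> \<V>" "V \<noteq> W" and FG: "F \<in> V" "G \<in> W"
    then obtain i j where "V \<in> C i" "W \<in> C j" by (auto simp: \<V>_def)
    then have "V \<in> C (max i j)" "W \<in> C (max i j)"
      using mono[of i "max i j"] mono[of j "max i j"] by auto
    then have "V \<subseteq> L2_complement M W"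
      using C[of "max i j"] \<open>V \<noteq> W\<close> by (simp add: decomposes_def)
    then show "L2_inner M F G = 0" using FG by (auto simp: L2_complement_def)
  next
    fix F and \<epsilon> :: real assume F: "F \<in> L2 M" and "0 < \<epsilon>"
    then obtain n G where G: "G \<in> E n" and less: "L2_norm M (\<lambda>x. F x - G x) < \<epsilon>"
      using E_dense by blast
    have "G \<in> L2_sums M \<V>"
      using G decomposes_sums[OF C, of n] L2_sums_mono[of "C n" \<V> M] unfolding \<V>_def by blast
    then obtain \<W> H where W: "finite \<W>" "\<W> \<subseteq> \<V>" "\<forall>V\<in>\<W>. H V \<in> V"
      "AE x in M. G x = (\<Sum>V\<in>\<W>. H V x)"
      unfolding L2_sums_def by blast
    have "H V \<in> L2 M" if V: "V \<in> \<W>" for V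
    proof -
      obtain n where "V \<in> C n" using V W(2) by (auto simp: \<V>_def)
      then show ?thesis using decomposes_subspace[OF C] L2_subspace_L2 W(3) V by blast
    qed
    then have HL2: "(\<lambda>x. \<Sum>V\<in>\<W>. H V x) \<in> L2 M" by auto
    have GL2: "G \<in> L2 M" using G E_L2 by auto
    have "L2_norm M (\<lambda>x. F x - (\<Sum>V\<in>\<W>. H V x)) = L2_norm M (\<lambda>x. F x - G x)"
    proof (rule L2_norm_cong_AE)
      show "AE x in M. F x - (\<Sum>V\<in>\<W>. H V x) = F x - G x"
        using W(4) by eventually_elim simp
    qed (use F GL2 HL2 in \<open>auto intro: L2_diff\<close>)
    then have "L2_norm M (\<lambda>x. F x - (\<Sum>V\<in>\<W>. H V x)) < \<epsilon>" using less by simp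
    with W(1-3) show "\<exists>\<W> G. finite \<W> \<and> \<W> \<subseteq> \<V> \<and> (\<forall>V\<in>\<W>. G V \<in> V) \<and>
        L2_norm M (\<lambda>x. F x - (\<Sum>V\<in>\<W>. G V x)) < \<epsilon>"
      by (intro exI[of _ \<W>] exI[of _ H] conjI)
  qed (use decomposes_summand[OF C] in \<open>auto simp: \<V>_def\<close>)
  moreover have "\<D>\<^sub>0 \<subseteq> \<V>" using C_def[of 0] by (auto simp: \<V>_def)
  ultimately show ?thesis by blast
qed

text \<open>A vector orthogonal to all \<open>E n\<close> is zero by density. Hence some \<open>E n\<close> is not orthogonal to a
  given irreducible \<open>V\<close>, and then no nonzero vector of \<open>V\<close> is orthogonal to \<open>E n\<close>.\<close>

lemma irreducible_meets_E:
  assumes V: "L2_irreducible M U V"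
  shows "\<exists>n. L2_trivial M (V \<inter> L2_complement M (E n))"
proof (rule ccontr)
  assume "\<not> ?thesis"
  then have nontriv: "\<not> L2_trivial M (V \<inter> L2_complement M (E n))" for n by blast
  have "V \<inter> L2_complement M (E n) = V" for n
  proof -
    have "L2_subspace M (V \<inter> L2_complement M (E n))" "L2_invariant U (V \<inter> L2_complement M (E n))"
      using V L2_subspace_Int[OF _ L2_subspace_complement[OF E_L2]]
        invariant_Int[OF _ invariant_complement[OF E_L2 E_invariant]]
      unfolding L2_irreducible_def by auto
    then show ?thesis using V nontriv[of n] unfolding L2_irreducible_def by blast
  qed
  then have orth: "V \<subseteq> L2_complement M (E n)" for n by blast
  have "AE x in M. F x = 0" if F: "F \<in> V" for F
  proof -
    have FL2: "F \<in> L2 M" using F V by (auto simp: L2_irreducible_def intro: L2_subspaceD)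
    have "(L2_norm M F)\<^sup>2 \<le> \<epsilon>" if pos: "\<epsilon> > 0" for \<epsilon>
    proof -
      obtain n G where G: "G \<in> E n" "L2_norm M (\<lambda>x. F x - G x) < sqrt \<epsilon>"
        using E_dense[OF FL2, of "sqrt \<epsilon>"] pos by auto
      have GL2: "G \<in> L2 M" using G E_L2 by auto
      have FG: "L2_inner M F G = 0" using orth[of n] F G by (auto simp: L2_complement_def)
      then have GF: "L2_inner M G F = 0" by (simp add: L2_inner_cnj[of M G F])
      let ?D = "\<lambda>x. F x + (-1) * G x"
      have "L2_inner M ?D ?D = L2_inner M F F + L2_inner M G G"
        using FL2 GL2 FG GF L2_inner_add_left[OF FL2 L2_scale[OF GL2], of ?D "-1"]
          L2_inner_add_right[OF FL2 L2_scale[OF GL2], of _ "-1"]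
        by (simp only: L2_inner_scale_left L2_inner_scale_right L2_add L2_scale) simp
      then have "(L2_norm M ?D)\<^sup>2 = (L2_norm M F)\<^sup>2 + (L2_norm M G)\<^sup>2"
        unfolding L2_inner_self by (metis of_real_add of_real_eq_iff)
      moreover have "(L2_norm M ?D)\<^sup>2 < (sqrt \<epsilon>)\<^sup>2"
        using G(2) L2_norm_nonneg[of M ?D] by (intro power_strict_mono) auto
      ultimately show ?thesis using pos by (simp add: add_increasing2) (smt (verit) zero_le_power2)
    qed
    then have "(L2_norm M F)\<^sup>2 \<le> 0" by (rule field_le_epsilon) auto
    then show ?thesis using L2_inner_self_eq_0_iff[OF FL2] L2_inner_self[of M F] by simp
  qed
  then show False using V by (auto simp: L2_irreducible_def L2_trivial_def)
qed

text \<open>For \<open>F \<in> V\<close> and \<open>G \<in> E n\<close>, moving \<open>U h\<close> to the other side of the inner product gives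
  \<open>\<langle>U h F - F, G\<rangle> = \<langle>F, U (adj h) G - G\<rangle> = 0\<close>.\<close>

lemma irreducible_fixed_if_E_fixed:
  assumes V: "L2_irreducible M U V"
    and triv: "L2_trivial M (V \<inter> L2_complement M (E n))"
    and fixed: "\<And>G. G \<in> E n \<Longrightarrow> AE x in M. U (adj h) G x = G x"
    and F: "F \<in> V"
  shows "AE x in M. U h F x = F x"
proof -
  have sub: "L2_subspace M V" and UF: "U h F \<in> V"
    using V F by (auto simp: L2_irreducible_def L2_invariant_def)
  have L2: "F \<in> L2 M" "U h F \<in> L2 M" using sub UF F by (auto intro: L2_subspaceD)
  have "L2_inner M (\<lambda>x. U h F x - F x) G = 0" if G: "G \<in> E n" for G
  proof -
    have GL2: "G \<in> L2 M" using G E_L2 by auto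
    have "L2_inner M (U h F) G = L2_inner M F (U (adj h) G)"
      by (rule U_adjoint[OF L2(1) GL2])
    also have "\<dots> = L2_inner M F G"
      using fixed[OF G] GL2 L2(1) U_L2[OF GL2] by (intro L2_inner_cong_AE) auto
    finally show ?thesis using L2 GL2 by (simp add: L2_inner_diff_left)
  qed
  then have "(\<lambda>x. U h F x - F x) \<in> V \<inter> L2_complement M (E n)"
    using L2 L2_subspace_diff[OF sub UF F] by (auto simp: L2_complement_def)
  with triv have "AE x in M. U h F x - F x = 0" unfolding L2_trivial_def by (rule bspec)
  then show ?thesis by simp
qed

end

section \<open>Density in a space generated by an intersection-stable family\<close>

definition L2_dist_sq :: "'a measure \<Rightarrow> ('a \<Rightarrow> complex) \<Rightarrow> ('a \<Rightarrow> complex) \<Rightarrow> real" where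
  "L2_dist_sq M F G = (LINT x|M. (cmod (F x - G x))\<^sup>2)"

lemma L2_dist_sq_triangle:
  assumes "F \<in> L2 M" "G \<in> L2 M" "H \<in> L2 M"
  shows "L2_dist_sq M F H \<le> 2 * L2_dist_sq M F G + 2 * L2_dist_sq M G H"
proof -
  have int: "integrable M (\<lambda>x. (cmod (F x - G x))\<^sup>2)" "integrable M (\<lambda>x. (cmod (G x - H x))\<^sup>2)"
    "integrable M (\<lambda>x. (cmod (F x - H x))\<^sup>2)"
    using assms by (auto intro!: L2_norm_sq_integrable L2_diff)
  have "L2_dist_sq M F H \<le> (LINT x|M. 2 * (cmod (F x - G x))\<^sup>2 + 2 * (cmod (G x - H x))\<^sup>2)"
    unfolding L2_dist_sq_def
  proof (rule integral_mono)
    show "(cmod (F x - H x))\<^sup>2 \<le> 2 * (cmod (F x - G x))\<^sup>2 + 2 * (cmod (G x - H x))\<^sup>2" for x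
      using cmod_add_sq_le[of "F x - G x" "G x - H x"] by simp
  qed (use int in auto)
  also have "\<dots> = 2 * L2_dist_sq M F G + 2 * L2_dist_sq M G H"
    unfolding L2_dist_sq_def using int by simp
  finally show ?thesis .
qed

text \<open>The factor 2 is the one that comes with the approximation of measurable functions by simple
  functions; it leads to the bound \<open>(1 + 2)\<^sup>2 * (cmod (F x))\<^sup>2\<close> for the squared distances.\<close>

lemma L2_dominated_convergence:
  assumes F: "F \<in> L2 M" and s: "\<And>i. s i \<in> borel_measurable M"
    and lim: "\<And>x. x \<in> space M \<Longrightarrow> (\<lambda>i. s i x) \<longlonglongrightarrow> F x"
    and bound: "\<And>i x. x \<in> space M \<Longrightarrow> cmod (s i x) \<le> 2 * cmod (F x)"
  shows "s i \<in> L2 M" and "(\<lambda>i. L2_dist_sq M F (s i)) \<longlonglongrightarrow> 0"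
proof -
  note [measurable] = L2_measurable[OF F] s
  show "s i \<in> L2 M"
  proof (rule L2_I[OF s], rule Bochner_Integration.integrable_bound)
    show "integrable M (\<lambda>x. 4 * (cmod (F x))\<^sup>2)" using L2_norm_sq_integrable[OF F] by simp
    show "AE x in M. norm ((cmod (s i x))\<^sup>2) \<le> norm (4 * (cmod (F x))\<^sup>2)"
    proof (rule AE_I2)
      fix x assume "x \<in> space M"
      then have "(cmod (s i x))\<^sup>2 \<le> (2 * cmod (F x))\<^sup>2" using bound by (intro power_mono) auto
      then show "norm ((cmod (s i x))\<^sup>2) \<le> norm (4 * (cmod (F x))\<^sup>2)" by (simp add: power_mult_distrib)
    qed
  qed measurable
  have "(\<lambda>i. LINT x|M. (cmod (F x - s i x))\<^sup>2) \<longlonglongrightarrow> (LINT x|M. 0)"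
  proof (rule integral_dominated_convergence)
    show "integrable M (\<lambda>x. 9 * (cmod (F x))\<^sup>2)" using L2_norm_sq_integrable[OF F] by simp
    show "AE x in M. (\<lambda>i. (cmod (F x - s i x))\<^sup>2) \<longlonglongrightarrow> 0"
    proof (rule AE_I2)
      fix x assume "x \<in> space M"
      then have "(\<lambda>i. (cmod (F x - s i x))\<^sup>2) \<longlonglongrightarrow> (cmod (F x - F x))\<^sup>2"
        by (intro tendsto_intros lim)
      then show "(\<lambda>i. (cmod (F x - s i x))\<^sup>2) \<longlonglongrightarrow> 0" by simp
    qed
    fix i show "AE x in M. norm ((cmod (F x - s i x))\<^sup>2) \<le> 9 * (cmod (F x))\<^sup>2"
    proof (rule AE_I2)
      fix x assume "x \<in> space M"
      then have "cmod (F x - s i x) \<le> 3 * cmod (F x)"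
        using bound[of x i] norm_triangle_ineq4[of "F x" "s i x"] by linarith
      then have "(cmod (F x - s i x))\<^sup>2 \<le> (3 * cmod (F x))\<^sup>2" by (intro power_mono) auto
      then show "norm ((cmod (F x - s i x))\<^sup>2) \<le> 9 * (cmod (F x))\<^sup>2" by (simp add: power_mult_distrib)
    qed
  qed auto
  then show "(\<lambda>i. L2_dist_sq M F (s i)) \<longlonglongrightarrow> 0" by (simp add: L2_dist_sq_def)
qed

text \<open>The closure \<open>\<D>\<close> of the union of the \<open>E n\<close> is a closed subspace. The sets with indicator function
  in \<open>\<D>\<close> form a Dynkin system, so they include all measurable sets. Hence \<open>\<D>\<close> contains the simple
  functions, and by dominated convergence everything.\<close>

lemma L2_dense_if_generating_indicators:
  fixes M :: "'a measure" and E :: "nat \<Rightarrow> ('a \<Rightarrow> complex) set"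
  assumes "finite_measure M"
    and gen: "Int_stable \<G>" "\<G> \<subseteq> Pow (space M)" "sets M = sigma_sets (space M) \<G>"
    and E: "\<And>n. L2_subspace M (E n)" and mono: "\<And>i j. i \<le> j \<Longrightarrow> E i \<subseteq> E j"
    and one: "(\<lambda>x. 1) \<in> E k" and ind: "\<And>S. S \<in> \<G> \<Longrightarrow> \<exists>n. indicator S \<in> E n"
    and F: "F \<in> L2 M" and "\<epsilon> > 0"
  shows "\<exists>n. \<exists>G\<in>E n. L2_norm M (\<lambda>x. F x - G x) < \<epsilon>"
proof -
  interpret finite_measure M by fact
  define \<D> where "\<D> = {F \<in> L2 M. \<forall>\<epsilon>>0. \<exists>n. \<exists>G\<in>E n. L2_dist_sq M F G < \<epsilon>}"
  have \<D>_L2: "F \<in> L2 M" if "F \<in> \<D>" for F using that by (simp add: \<D>_def)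
  have E_L2: "G \<in> L2 M" if "G \<in> E n" for G n using E that by (rule L2_subspace_L2)
  have base: "F \<in> \<D>" if "F \<in> E n" for F n
    using that E_L2[OF that] by (auto simp: \<D>_def L2_dist_sq_def intro!: exI[of _ n] bexI[of _ F])
  have add: "(\<lambda>x. F x + G x) \<in> \<D>" if F: "F \<in> \<D>" and G: "G \<in> \<D>" for F G
  proof -
    have "\<exists>n. \<exists>H\<in>E n. L2_dist_sq M (\<lambda>x. F x + G x) H < \<epsilon>" if \<epsilon>: "\<epsilon> > 0" for \<epsilon>
    proof -
      have "\<epsilon> / 4 > 0" using \<epsilon> by simp
      then obtain i j F' G' where F': "F' \<in> E i" "L2_dist_sq M F F' < \<epsilon> / 4"
        and G': "G' \<in> E j" "L2_dist_sq M G G' < \<epsilon> / 4"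
        using F G unfolding \<D>_def by blast
      let ?H = "\<lambda>x. F' x + G' x"
      have H: "?H \<in> E (max i j)"
        using F'(1) G'(1) mono[of i "max i j"] mono[of j "max i j"] by (intro L2_subspace_add[OF E]) auto
      have "L2_dist_sq M (\<lambda>x. F x + G x) ?H
        \<le> 2 * L2_dist_sq M (\<lambda>x. F x + G x) (\<lambda>x. F' x + G x) + 2 * L2_dist_sq M (\<lambda>x. F' x + G x) ?H"
        using F G F'(1) G'(1) by (intro L2_dist_sq_triangle L2_add) (auto intro: \<D>_L2 E_L2)
      also have "\<dots> = 2 * L2_dist_sq M F F' + 2 * L2_dist_sq M G G'"
        by (simp add: L2_dist_sq_def)
      also have "\<dots> < \<epsilon>" using F'(2) G'(2) by simp
      finally show ?thesis using H by blast
    qed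
    then show ?thesis using F G by (auto simp: \<D>_def)
  qed
  have scale: "(\<lambda>x. c * F x) \<in> \<D>" if F: "F \<in> \<D>" for F c
  proof (cases "c = 0")
    case True
    then show ?thesis using base[OF L2_subspace_zero[OF E]] by simp
  next
    case False
    have "\<exists>n. \<exists>H\<in>E n. L2_dist_sq M (\<lambda>x. c * F x) H < \<epsilon>" if \<epsilon>: "\<epsilon> > 0" for \<epsilon>
    proof -
      have "\<epsilon> / (cmod c)\<^sup>2 > 0" using \<epsilon> False by simp
      then obtain n G where G: "G \<in> E n" "L2_dist_sq M F G < \<epsilon> / (cmod c)\<^sup>2"
        using F unfolding \<D>_def by blast
      have "L2_dist_sq M (\<lambda>x. c * F x) (\<lambda>x. c * G x) = (cmod c)\<^sup>2 * L2_dist_sq M F G"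
        by (simp add: L2_dist_sq_def norm_mult power_mult_distrib flip: right_diff_distrib)
      also have "\<dots> < \<epsilon>" using G(2) False by (simp add: field_simps)
      finally show ?thesis using L2_subspace_scale[OF E G(1)] by blast
    qed
    then show ?thesis using F by (auto simp: \<D>_def)
  qed
  have lim: "F \<in> \<D>" if F: "F \<in> L2 M" and s: "\<And>i. s i \<in> \<D>"
    and conv: "(\<lambda>i::nat. L2_dist_sq M F (s i)) \<longlonglongrightarrow> 0" for F s
  proof -
    have "\<exists>n. \<exists>H\<in>E n. L2_dist_sq M F H < \<epsilon>" if \<epsilon>: "\<epsilon> > 0" for \<epsilon>
    proof -
      have "\<epsilon> / 4 > 0" using \<epsilon> by simp
      from order_tendstoD(2)[OF conv this] obtain i where i: "L2_dist_sq M F (s i) < \<epsilon> / 4"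
        by (auto simp: eventually_sequentially)
      from s[of i] \<open>\<epsilon> / 4 > 0\<close> obtain n G where G: "G \<in> E n" "L2_dist_sq M (s i) G < \<epsilon> / 4"
        unfolding \<D>_def by blast
      have "L2_dist_sq M F G \<le> 2 * L2_dist_sq M F (s i) + 2 * L2_dist_sq M (s i) G"
        using F s G(1) by (intro L2_dist_sq_triangle) (auto intro: \<D>_L2 E_L2)
      also have "\<dots> < \<epsilon>" using i G(2) by simp
      finally show ?thesis using G(1) by blast
    qed
    then show ?thesis using F by (auto simp: \<D>_def)
  qed
  have ae: "G \<in> \<D>" if F: "F \<in> \<D>" and G: "G \<in> borel_measurable M"
    and eq: "\<And>x. x \<in> space M \<Longrightarrow> F x = G x" for F G
  proof -
    have "integrable M (\<lambda>x. (cmod (F x))\<^sup>2) \<longleftrightarrow> integrable M (\<lambda>x. (cmod (G x))\<^sup>2)"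
      by (intro Bochner_Integration.integrable_cong) (auto simp: eq)
    then have GL2: "G \<in> L2 M" using \<D>_L2[OF F] G by (simp add: L2_def)
    have "L2_dist_sq M G F = 0" unfolding L2_dist_sq_def
      by (subst Bochner_Integration.integral_cong[OF refl, of _ _ "\<lambda>_. 0"]) (auto simp: eq)
    then show ?thesis using lim[of G "\<lambda>_. F"] F GL2 by simp
  qed
  have sum: "(\<lambda>x. \<Sum>i\<in>I. f i x) \<in> \<D>" if "\<And>i. i \<in> I \<Longrightarrow> f i \<in> \<D>" for I :: "'b set" and f
    using that by (induction I rule: infinite_finite_induct) (auto intro: add base[OF L2_subspace_zero[OF E]])
  have ind_L2: "indicator S \<in> L2 M" if "S \<in> sets M" for S
  proof -
    have "(\<lambda>x. (cmod (indicator S x))\<^sup>2) = (indicator S :: 'a \<Rightarrow> real)"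
      by (auto simp: indicator_def)
    then show ?thesis using that by (auto simp: L2_def less_top[symmetric])
  qed
  have indicators: "indicator S \<in> \<D>" if "S \<in> sets M" for S
    using gen(1,2) that[unfolded gen(3)]
  proof (induction rule: sigma_sets_induct_disjoint)
    case (basic A)
    then show ?case using ind base by blast
  next
    case empty
    then show ?case using base[OF L2_subspace_zero[OF E]] by (simp add: indicator_def)
  next
    case (compl A)
    then have "A \<in> sets M" using gen(3) by simp
    have "(\<lambda>x. 1 + (-1) * indicator A x) \<in> \<D>"
      by (intro add scale compl.IH base[OF one])
    moreover have "indicator (space M - A) \<in> borel_measurable M" using \<open>A \<in> sets M\<close> by measurable
    ultimately show ?case by (rule ae) (auto simp: indicator_def)
  next
    case (union A)
    have A: "A i \<in> sets M" for i using union.hyps gen(3) by auto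
    let ?s = "\<lambda>i x. \<Sum>j<i. indicator (A j) x :: complex"
    have s: "?s i x = indicator (\<Union>j<i. A j) x" for i x
      using union.hyps(1) by (subst indicator_UN_disjoint) (auto simp: disjoint_family_on_def)
    have UL2: "indicator (\<Union>i. A i) \<in> L2 M" using A by (intro ind_L2) auto
    have meas: "?s i \<in> borel_measurable M" for i using A by measurable
    have conv: "(\<lambda>i. ?s i x) \<longlonglongrightarrow> indicator (\<Union>i. A i) x" for x
      unfolding s by (rule LIMSEQ_indicator_UN)
    have bound: "cmod (?s i x) \<le> 2 * cmod (indicator (\<Union>i. A i) x)" for i x
      unfolding s by (auto simp: indicator_def)
    show ?case
      by (rule lim[OF UL2 sum[OF union.IH] L2_dominated_convergence(2)[OF UL2 meas conv bound]])
  qed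
  have simple: "s \<in> \<D>" if s: "simple_function M s" for s
  proof (rule ae)
    show "(\<lambda>x. \<Sum>y\<in>s ` space M. y * indicator (s -` {y} \<inter> space M) x) \<in> \<D>"
      using simple_functionD(2)[OF s] by (intro sum scale indicators) auto
    show "s \<in> borel_measurable M" using s by (rule borel_measurable_simple_function)
    fix x assume "x \<in> space M"
    then have "(\<Sum>y\<in>s ` space M. y * indicator (s -` {y} \<inter> space M) x)
      = (\<Sum>y\<in>s ` space M. if y = s x then y else 0)"
      by (intro sum.cong) (auto simp: indicator_def)
    also have "\<dots> = s x" using simple_functionD(1)[OF s] \<open>x \<in> space M\<close> by simp
    finally show "(\<Sum>y\<in>s ` space M. y * indicator (s -` {y} \<inter> space M) x) = s x" .
  qed
  from borel_measurable_implies_sequence_metric[OF L2_measurable[OF F], of 0]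
  obtain s where s: "\<And>i. simple_function M (s i)" "\<And>x. x \<in> space M \<Longrightarrow> (\<lambda>i. s i x) \<longlonglongrightarrow> F x"
    "\<And>i x. x \<in> space M \<Longrightarrow> cmod (s i x) \<le> 2 * cmod (F x)"
    by (simp del: split_paired_All) metis
  have "F \<in> \<D>"
    by (rule lim[OF F simple[OF s(1)] L2_dominated_convergence(2)[OF F borel_measurable_simple_function[OF s(1)] s(2,3)]])
  moreover have "\<epsilon>\<^sup>2 > 0" using \<open>\<epsilon> > 0\<close> by simp
  ultimately obtain n G where G: "G \<in> E n" "L2_dist_sq M F G < \<epsilon>\<^sup>2" unfolding \<D>_def by blast
  have "L2_norm M (\<lambda>x. F x - G x) < \<epsilon>"
    using G(2) \<open>\<epsilon> > 0\<close> unfolding L2_norm_def L2_dist_sq_def by (simp add: real_less_lsqrt)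
  with G(1) show ?thesis by blast
qed

section \<open>The odometer action\<close>

interpretation heis: group Heis by (rule group_Heis)

lemma carrier_Heis [simp]: "carrier Heis = UNIV"
  by (simp add: Heis_def)

lemma mult_Heis [simp]: "(x, y, z) \<otimes>\<^bsub>Heis\<^esub> (x', y', z') = (x + x', y + y', z + z' + x * y')"
  by (simp add: Heis_def)

lemma one_Heis [simp]: "\<one>\<^bsub>Heis\<^esub> = (0, 0, 0)"
  by (simp add: Heis_def)

lemma inv_Heis: "inv\<^bsub>Heis\<^esub> (x, y, z) = (- x, - y, x * y - z)"
  by (rule heis.inv_equality) auto

locale heis_odometer_measure =
  fixes \<Gamma> :: "nat \<Rightarrow> heis set" and \<mu> :: "(nat \<Rightarrow> heis set) measure"
  assumes odometer: "heis_odometer \<Gamma>"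
    and haar: "haar_probability (odometer_group \<Gamma>) (odometer_topology \<Gamma>) \<mu>"
begin

lemma normal: "\<Gamma> n \<lhd> Heis" and finite_rcosets: "finite (rcosets\<^bsub>Heis\<^esub> (\<Gamma> n))"
  and antimono: "i \<le> j \<Longrightarrow> \<Gamma> j \<subseteq> \<Gamma> i"
  using odometer by (auto simp: heis_odometer_def decseq_def)

lemma subgroup: "subgroup (\<Gamma> n) Heis"
  by (rule normal_imp_subgroup[OF normal])

lemma rcosetE:
  assumes "C \<in> rcosets\<^bsub>Heis\<^esub> (\<Gamma> n)"
  obtains h where "C = \<Gamma> n #>\<^bsub>Heis\<^esub> h"
  using assms by (auto simp: RCOSETS_def)

lemma rcosetI: "\<Gamma> n #>\<^bsub>Heis\<^esub> h \<in> rcosets\<^bsub>Heis\<^esub> (\<Gamma> n)"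
  by (rule heis.rcosetsI) auto

lemma rcoset_eq_if_mem: "C \<in> rcosets\<^bsub>Heis\<^esub> (\<Gamma> n) \<Longrightarrow> h \<in> C \<Longrightarrow> C = \<Gamma> n #>\<^bsub>Heis\<^esub> h"
  using heis.repr_independence[OF _ _ subgroup, of h n] by (auto simp: RCOSETS_def)

lemma mem_rcoset_self: "h \<in> \<Gamma> n #>\<^bsub>Heis\<^esub> h"
  using heis.rcos_self[OF _ subgroup, of h n] by simp

lemma lcos_rcos: "h <#\<^bsub>Heis\<^esub> (\<Gamma> n #>\<^bsub>Heis\<^esub> k) = \<Gamma> n #>\<^bsub>Heis\<^esub> (h \<otimes>\<^bsub>Heis\<^esub> k)"
proof -
  have "h <#\<^bsub>Heis\<^esub> (\<Gamma> n #>\<^bsub>Heis\<^esub> k) = (h <#\<^bsub>Heis\<^esub> \<Gamma> n) #>\<^bsub>Heis\<^esub> k"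
    using heis.coset_assoc[of h k "\<Gamma> n"] by simp
  also have "h <#\<^bsub>Heis\<^esub> \<Gamma> n = \<Gamma> n #>\<^bsub>Heis\<^esub> h"
    using normal.coset_eq[OF normal] by (simp del: split_paired_All)
  finally show ?thesis by (simp add: heis.coset_mult_assoc)
qed

lemma rcos_mult:
  "(\<Gamma> n #>\<^bsub>Heis\<^esub> h) <#>\<^bsub>Heis\<^esub> (\<Gamma> n #>\<^bsub>Heis\<^esub> k) = \<Gamma> n #>\<^bsub>Heis\<^esub> (h \<otimes>\<^bsub>Heis\<^esub> k)"
  using normal.rcos_sum[OF normal, of h k] by simp

lemma quotient_map: "i \<le> j \<Longrightarrow> \<Gamma> i <#>\<^bsub>Heis\<^esub> (\<Gamma> j #>\<^bsub>Heis\<^esub> h) = \<Gamma> i #>\<^bsub>Heis\<^esub> h"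
proof -
  assume ij: "i \<le> j"
  have "\<Gamma> i <#>\<^bsub>Heis\<^esub> \<Gamma> j \<subseteq> \<Gamma> i <#>\<^bsub>Heis\<^esub> \<Gamma> i" using antimono[OF ij] by (intro mono_set_mult) auto
  also have "\<dots> = \<Gamma> i" by (rule heis.subgroup_mult_id[OF subgroup])
  finally have "\<Gamma> i <#>\<^bsub>Heis\<^esub> \<Gamma> j \<subseteq> \<Gamma> i" .
  moreover have "\<Gamma> i \<subseteq> \<Gamma> i <#>\<^bsub>Heis\<^esub> \<Gamma> j"
  proof
    fix g assume "g \<in> \<Gamma> i"
    moreover have "\<one>\<^bsub>Heis\<^esub> \<in> \<Gamma> j" by (rule subgroup.one_closed[OF subgroup])
    ultimately have "g \<otimes>\<^bsub>Heis\<^esub> \<one>\<^bsub>Heis\<^esub> \<in> \<Gamma> i <#>\<^bsub>Heis\<^esub> \<Gamma> j" unfolding set_mult_def by blast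
    then show "g \<in> \<Gamma> i <#>\<^bsub>Heis\<^esub> \<Gamma> j" using heis.r_one[of g] by (simp del: one_Heis)
  qed
  ultimately show ?thesis by (simp add: heis.setmult_rcos_assoc)
qed

abbreviation \<Omega> :: "(nat \<Rightarrow> heis set) set" where "\<Omega> \<equiv> carrier (odometer_group \<Gamma>)"

abbreviation act :: "heis \<Rightarrow> (nat \<Rightarrow> heis set) \<Rightarrow> nat \<Rightarrow> heis set" where "act \<equiv> odometer_act"

lemma mem_\<Omega>_iff:
  "X \<in> \<Omega> \<longleftrightarrow> (\<forall>n. X n \<in> rcosets\<^bsub>Heis\<^esub> (\<Gamma> n)) \<and> (\<forall>n. X n = \<Gamma> n <#>\<^bsub>Heis\<^esub> X (Suc n))"
  by (simp add: odometer_group_def FactGroup_def)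

lemma \<Omega>_rcoset: "X \<in> \<Omega> \<Longrightarrow> X n \<in> rcosets\<^bsub>Heis\<^esub> (\<Gamma> n)"
  and \<Omega>_step: "X \<in> \<Omega> \<Longrightarrow> X n = \<Gamma> n <#>\<^bsub>Heis\<^esub> X (Suc n)"
  unfolding mem_\<Omega>_iff by blast+

lemma \<Omega>_rcosetE:
  assumes "X \<in> \<Omega>"
  obtains h where "X n = \<Gamma> n #>\<^bsub>Heis\<^esub> h"
  using \<Omega>_rcoset[OF assms, of n] rcosetE by blast

lemma \<Omega>_lower_level:
  assumes X: "X \<in> \<Omega>" and "n \<le> m" "X m = \<Gamma> m #>\<^bsub>Heis\<^esub> h"
  shows "X n = \<Gamma> n #>\<^bsub>Heis\<^esub> h"
  using assms(2,3)
proof (induction n rule: inc_induct)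
  case (step n)
  have "X n = \<Gamma> n <#>\<^bsub>Heis\<^esub> X (Suc n)" by (rule \<Omega>_step[OF X])
  also have "X (Suc n) = \<Gamma> (Suc n) #>\<^bsub>Heis\<^esub> h" by (rule step.IH[OF step.prems])
  finally show ?case by (simp add: quotient_map)
qed simp

lemma \<Omega>_lower_level_eq:
  assumes "X \<in> \<Omega>" "Y \<in> \<Omega>" "n \<le> m" "X m = Y m"
  shows "X n = Y n"
proof -
  obtain h where "X m = \<Gamma> m #>\<^bsub>Heis\<^esub> h" by (rule \<Omega>_rcosetE[OF assms(1)])
  then show ?thesis using \<Omega>_lower_level[OF assms(1,3)] \<Omega>_lower_level[OF assms(2,3)] assms(4) by simp
qed

lemma \<Omega>_projection:
  assumes "X \<in> \<Omega>" "n \<le> m"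
  shows "X n = \<Gamma> n <#>\<^bsub>Heis\<^esub> X m"
proof -
  obtain h where h: "X m = \<Gamma> m #>\<^bsub>Heis\<^esub> h" by (rule \<Omega>_rcosetE[OF assms(1)])
  then show ?thesis using \<Omega>_lower_level[OF assms h] by (simp add: quotient_map[OF assms(2)])
qed

lemma act_level: "X n = \<Gamma> n #>\<^bsub>Heis\<^esub> k \<Longrightarrow> act h X n = \<Gamma> n #>\<^bsub>Heis\<^esub> (h \<otimes>\<^bsub>Heis\<^esub> k)"
  by (simp add: odometer_act_def lcos_rcos)

lemma act_\<Omega>:
  assumes X: "X \<in> \<Omega>"
  shows "act h X \<in> \<Omega>"
  unfolding mem_\<Omega>_iff
proof (intro conjI allI)
  fix n
  obtain k where k: "X (Suc n) = \<Gamma> (Suc n) #>\<^bsub>Heis\<^esub> k" by (rule \<Omega>_rcosetE[OF X])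
  then have "X n = \<Gamma> n #>\<^bsub>Heis\<^esub> k" using \<Omega>_lower_level[OF X, of n "Suc n"] by simp
  with k show "act h X n \<in> rcosets\<^bsub>Heis\<^esub> (\<Gamma> n)" "act h X n = \<Gamma> n <#>\<^bsub>Heis\<^esub> act h X (Suc n)"
    by (simp_all add: act_level quotient_map rcosetI)
qed

lemma act_mult: "X \<in> \<Omega> \<Longrightarrow> act h (act k X) = act (h \<otimes>\<^bsub>Heis\<^esub> k) X"
proof
  fix n assume "X \<in> \<Omega>"
  then obtain j where "X n = \<Gamma> n #>\<^bsub>Heis\<^esub> j" by (rule \<Omega>_rcosetE)
  then show "act h (act k X) n = act (h \<otimes>\<^bsub>Heis\<^esub> k) X n" by (simp only: act_level heis.m_assoc carrier_Heis UNIV_I)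
qed

lemma act_one: "X \<in> \<Omega> \<Longrightarrow> act \<one>\<^bsub>Heis\<^esub> X = X"
proof
  fix n assume "X \<in> \<Omega>"
  then obtain j where "X n = \<Gamma> n #>\<^bsub>Heis\<^esub> j" by (rule \<Omega>_rcosetE)
  then show "act \<one>\<^bsub>Heis\<^esub> X n = X n" by (simp only: act_level heis.l_one carrier_Heis UNIV_I)
qed

lemma act_inv_act: "X \<in> \<Omega> \<Longrightarrow> act (inv\<^bsub>Heis\<^esub> h) (act h X) = X"
  "X \<in> \<Omega> \<Longrightarrow> act h (act (inv\<^bsub>Heis\<^esub> h) X) = X"
  using heis.l_inv[of h] heis.r_inv[of h] act_one by (simp_all add: act_mult)

text \<open>Haar measure is invariant under left translations of the inverse limit; acting by \<open>h\<close> is the one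
  by \<open>embed h\<close>.\<close>

definition embed :: "heis \<Rightarrow> nat \<Rightarrow> heis set" where "embed h = (\<lambda>n. \<Gamma> n #>\<^bsub>Heis\<^esub> h)"

lemma embed_\<Omega>: "embed h \<in> \<Omega>"
  by (simp add: mem_\<Omega>_iff embed_def rcosetI quotient_map)

lemma act_eq_translation: "X \<in> \<Omega> \<Longrightarrow> act h X = embed h \<otimes>\<^bsub>odometer_group \<Gamma>\<^esub> X"
proof
  fix n assume "X \<in> \<Omega>"
  then obtain j where "X n = \<Gamma> n #>\<^bsub>Heis\<^esub> j" by (rule \<Omega>_rcosetE)
  then show "act h X n = (embed h \<otimes>\<^bsub>odometer_group \<Gamma>\<^esub> X) n"
    by (simp add: act_level odometer_group_def embed_def rcos_mult)
qed

subsection \<open>Cylinder sets\<close>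

definition cylinder :: "nat \<Rightarrow> heis set \<Rightarrow> (nat \<Rightarrow> heis set) set" where
  "cylinder n C = {X \<in> \<Omega>. X n = C}"

lemma openin_cylinder: "openin (odometer_topology \<Gamma>) (cylinder n C)"
proof -
  let ?T = "\<lambda>n. discrete_topology (carrier (Heis Mod \<Gamma> n))"
  let ?U = "\<lambda>i. if i = n then {C} \<inter> topspace (?T i) else topspace (?T i)"
  have "openin (product_topology ?T UNIV) (Pi\<^sub>E UNIV ?U)"
  proof (subst openin_PiE_gen, intro disjI2 conjI ballI)
    have "{i \<in> UNIV. ?U i \<noteq> topspace (?T i)} \<subseteq> {n}" by auto
    then show "finite {i \<in> UNIV. ?U i \<noteq> topspace (?T i)}" by (rule finite_subset) simp
  qed auto
  moreover have "cylinder n C = Pi\<^sub>E UNIV ?U \<inter> \<Omega>"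
    using \<Omega>_rcoset by (auto simp: cylinder_def FactGroup_def PiE_def Pi_def split: if_splits)
  ultimately show ?thesis
    unfolding odometer_topology_def openin_subtopology by blast
qed

text \<open>A basic open set of the product constrains finitely many components, and on the inverse limit
  the largest of their indices decides about all of them.\<close>

lemma open_contains_cylinder:
  assumes S: "openin (odometer_topology \<Gamma>) S" and X: "X \<in> S"
  shows "\<exists>n. cylinder n (X n) \<subseteq> S"
proof -
  let ?T = "\<lambda>n. discrete_topology (carrier (Heis Mod \<Gamma> n))"
  obtain S' where S': "openin (product_topology ?T UNIV) S'" "S = S' \<inter> \<Omega>"
    using S unfolding odometer_topology_def openin_subtopology by blast
  then obtain U where U: "finite {i. U i \<noteq> topspace (?T i)}" "X \<in> Pi\<^sub>E UNIV U" "Pi\<^sub>E UNIV U \<subseteq> S'"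
    using X unfolding openin_product_topology_alt by auto
  obtain n where n: "\<And>i. U i \<noteq> topspace (?T i) \<Longrightarrow> i \<le> n"
    using U(1) finite_nat_set_iff_bounded_le by auto
  have "cylinder n (X n) \<subseteq> S"
  proof
    fix Y assume Y: "Y \<in> cylinder n (X n)"
    then have Y\<Omega>: "Y \<in> \<Omega>" and Yn: "Y n = X n" by (auto simp: cylinder_def)
    have "Y i \<in> U i" for i
    proof (cases "U i = topspace (?T i)")
      case True
      then show ?thesis using \<Omega>_rcoset[OF Y\<Omega>] by (simp add: FactGroup_def)
    next
      case False
      then have "Y i = X i" using n Y\<Omega> Yn X S'(2) \<Omega>_lower_level_eq[of Y X i n] by auto
      then show ?thesis using U(2) by (auto simp: PiE_def)
    qed
    then have "Y \<in> S'" using U(3) by auto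
    then show "Y \<in> S" using S'(2) Y\<Omega> by blast
  qed
  then show ?thesis by blast
qed

lemma prob_space_\<mu>: "prob_space \<mu>" and space_\<mu> [simp]: "space \<mu> = \<Omega>"
  and sets_\<mu>_open: "sets \<mu> = sigma_sets \<Omega> {S. openin (odometer_topology \<Gamma>) S}"
  and translation: "X \<in> \<Omega> \<Longrightarrow> S \<in> sets \<mu> \<Longrightarrow>
    emeasure \<mu> ((\<lambda>Y. X \<otimes>\<^bsub>odometer_group \<Gamma>\<^esub> Y) ` S) = emeasure \<mu> S"
  using haar by (auto simp: haar_probability_def)

sublocale prob_space \<mu> by (rule prob_space_\<mu>)

definition cylinders :: "(nat \<Rightarrow> heis set) set set" where
  "cylinders = {cylinder n C | n C. True}"

lemma cylinders_subset: "cylinders \<subseteq> Pow \<Omega>"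
  by (auto simp: cylinders_def cylinder_def)

text \<open>Cylinders form a countable base of the topology, as each level has finitely many cosets.\<close>

lemma sets_\<mu>: "sets \<mu> = sigma_sets \<Omega> cylinders"
  unfolding sets_\<mu>_open
proof (rule sigma_sets_eqI)
  fix S assume "S \<in> {S. openin (odometer_topology \<Gamma>) S}"
  then have S: "openin (odometer_topology \<Gamma>) S" by simp
  interpret sigma: sigma_algebra \<Omega> "sigma_sets \<Omega> cylinders"
    by (rule sigma_algebra_sigma_sets[OF cylinders_subset])
  let ?I = "{(n, C) \<in> (SIGMA n:UNIV. rcosets\<^bsub>Heis\<^esub> (\<Gamma> n)). cylinder n C \<subseteq> S}"
  have "countable (SIGMA n:UNIV. rcosets\<^bsub>Heis\<^esub> (\<Gamma> n))"
    by (intro countable_SIGMA) (auto intro: countable_finite finite_rcosets)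
  then have countable: "countable ?I" by (rule countable_subset[rotated]) auto
  have "S \<subseteq> (\<Union>(n, C)\<in>?I. cylinder n C)"
  proof
    fix X assume X: "X \<in> S"
    then have X\<Omega>: "X \<in> \<Omega>"
      using openin_subset[OF S] by (auto simp: odometer_topology_def topspace_subtopology)
    obtain n where "cylinder n (X n) \<subseteq> S" using open_contains_cylinder[OF S X] by blast
    moreover have "X \<in> cylinder n (X n)" using X\<Omega> by (simp add: cylinder_def)
    ultimately show "X \<in> (\<Union>(n, C)\<in>?I. cylinder n C)"
      using \<Omega>_rcoset[OF X\<Omega>] by (intro UN_I[of "(n, X n)"]) simp_all
  qed
  then have "S = (\<Union>(n, C)\<in>?I. cylinder n C)" by blast
  moreover have "(\<Union>(n, C)\<in>?I. cylinder n C) \<in> sigma_sets \<Omega> cylinders"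
    using countable by (intro sigma.countable_UN') (auto simp: cylinders_def)
  ultimately show "S \<in> sigma_sets \<Omega> cylinders" by simp
next
  fix S assume "S \<in> cylinders"
  then show "S \<in> sigma_sets \<Omega> {S. openin (odometer_topology \<Gamma>) S}"
    using openin_cylinder by (auto simp: cylinders_def)
qed

lemma cylinder_sets [measurable]: "cylinder n C \<in> sets \<mu>"
  unfolding sets_\<mu> by (auto simp: cylinders_def)

text \<open>Of two cylinders that meet, the one at the higher level is contained in the other.\<close>

lemma Int_stable_cylinders: "Int_stable cylinders"
proof (rule Int_stableI)
  fix S T assume "S \<in> cylinders" "T \<in> cylinders"
  then obtain n C m D where ST: "S = cylinder n C" "T = cylinder m D"
    unfolding cylinders_def by blast
  have *: "cylinder n C \<inter> cylinder m D \<in> cylinders" if "n \<le> m" for n C m D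
  proof (cases "cylinder n C \<inter> cylinder m D = {}")
    case True
    moreover have "cylinder 0 {} = {}"
      using \<Omega>_rcoset[of _ 0] mem_rcoset_self by (fastforce simp: cylinder_def elim: rcosetE)
    ultimately show ?thesis unfolding cylinders_def by blast
  next
    case False
    then obtain X where X: "X \<in> \<Omega>" "X n = C" "X m = D" by (auto simp: cylinder_def)
    have "Y n = C" if "Y \<in> \<Omega>" "Y m = D" for Y
      using \<Omega>_lower_level_eq[OF that(1) X(1) \<open>n \<le> m\<close>] that(2) X(2,3) by simp
    then have "cylinder n C \<inter> cylinder m D = cylinder m D" unfolding cylinder_def by blast
    then show ?thesis unfolding cylinders_def by blast
  qed
  show "S \<inter> T \<in> cylinders"
    using *[of n m C D] *[of m n D C] ST by (cases "n \<le> m") (auto simp: Int_commute)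
qed

lemma level_sets: "{X \<in> \<Omega>. P (X n)} \<in> sets \<mu>"
proof -
  have "{X \<in> \<Omega>. P (X n)} = (\<Union>C\<in>{C \<in> rcosets\<^bsub>Heis\<^esub> (\<Gamma> n). P C}. cylinder n C)"
    using \<Omega>_rcoset by (auto simp: cylinder_def)
  also have "\<dots> \<in> sets \<mu>" using finite_rcosets by (intro sets.finite_UN) auto
  finally show ?thesis .
qed

lemma level_measurable: "(\<lambda>X. \<phi> (X n)) \<in> borel_measurable \<mu>" for \<phi> :: "heis set \<Rightarrow> complex"
proof (rule measurableI)
  fix S :: "complex set"
  show "(\<lambda>X. \<phi> (X n)) -` S \<inter> space \<mu> \<in> sets \<mu>"
    using level_sets[of "\<lambda>C. \<phi> C \<in> S" n] by (simp add: vimage_def Int_def conj_commute)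
qed simp

lemma level_L2: "(\<lambda>X. \<phi> (X n)) \<in> L2 \<mu>" for \<phi> :: "heis set \<Rightarrow> complex"
proof (rule L2_I[OF level_measurable])
  show "integrable \<mu> (\<lambda>X. (cmod (\<phi> (X n)))\<^sup>2)"
  proof (rule integrable_const_bound)
    show "AE X in \<mu>. norm ((cmod (\<phi> (X n)))\<^sup>2) \<le> (\<Sum>C\<in>rcosets\<^bsub>Heis\<^esub> (\<Gamma> n). (cmod (\<phi> C))\<^sup>2)"
    proof (rule AE_I2)
      fix X assume "X \<in> space \<mu>"
      then have "X n \<in> rcosets\<^bsub>Heis\<^esub> (\<Gamma> n)" by (simp add: \<Omega>_rcoset)
      then show "norm ((cmod (\<phi> (X n)))\<^sup>2) \<le> (\<Sum>C\<in>rcosets\<^bsub>Heis\<^esub> (\<Gamma> n). (cmod (\<phi> C))\<^sup>2)"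
        using member_le_sum[of "X n" _ "\<lambda>C. (cmod (\<phi> C))\<^sup>2", OF _ _ finite_rcosets] by simp
    qed
    show "(\<lambda>X. (cmod (\<phi> (X n)))\<^sup>2) \<in> borel_measurable \<mu>"
      using level_measurable[of \<phi> n] by measurable
  qed
qed

subsection \<open>Invariance of the measure\<close>

lemma act_image_eq_vimage:
  assumes "S \<subseteq> \<Omega>"
  shows "act h ` (act h -` S \<inter> \<Omega>) = S"
proof
  show "S \<subseteq> act h ` (act h -` S \<inter> \<Omega>)"
  proof
    fix X assume X: "X \<in> S"
    then have "X \<in> \<Omega>" using assms by blast
    then show "X \<in> act h ` (act h -` S \<inter> \<Omega>)"
      using X by (intro image_eqI[of _ _ "act (inv\<^bsub>Heis\<^esub> h) X"]) (simp_all add: act_inv_act act_\<Omega>)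
  qed
qed auto

lemma act_measurable [measurable]: "act h \<in> measurable \<mu> \<mu>"
proof (rule measurable_sigma_sets)
  show "sets \<mu> = sigma_sets \<Omega> cylinders" by (rule sets_\<mu>)
  show "cylinders \<subseteq> Pow \<Omega>" by (rule cylinders_subset)
  show "act h \<in> space \<mu> \<rightarrow> \<Omega>" by (simp add: act_\<Omega>)
  fix S assume "S \<in> cylinders"
  then obtain n C where "S = cylinder n C" unfolding cylinders_def by blast
  then have "act h X \<in> S \<longleftrightarrow> h <#\<^bsub>Heis\<^esub> X n = C" if "X \<in> \<Omega>" for X
    using act_\<Omega>[OF that, of h] by (simp add: cylinder_def) (simp add: odometer_act_def)
  then have "act h -` S \<inter> space \<mu> = {X \<in> \<Omega>. h <#\<^bsub>Heis\<^esub> X n = C}" by auto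
  then show "act h -` S \<inter> space \<mu> \<in> sets \<mu>" using level_sets[of "\<lambda>D. h <#\<^bsub>Heis\<^esub> D = C" n] by simp
qed

lemma distr_act: "distr \<mu> \<mu> (act h) = \<mu>"
proof (rule measure_eqI)
  fix S assume "S \<in> sets (distr \<mu> \<mu> (act h))"
  then have S: "S \<in> sets \<mu>" by simp
  let ?T = "act h -` S \<inter> \<Omega>"
  have T: "?T \<in> sets \<mu>" using measurable_sets[OF act_measurable S] by simp
  have "emeasure (distr \<mu> \<mu> (act h)) S = emeasure \<mu> ?T" using S by (simp add: emeasure_distr)
  also have "\<dots> = emeasure \<mu> ((\<lambda>Y. embed h \<otimes>\<^bsub>odometer_group \<Gamma>\<^esub> Y) ` ?T)"
    by (rule translation[OF embed_\<Omega> T, symmetric])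
  also have "(\<lambda>Y. embed h \<otimes>\<^bsub>odometer_group \<Gamma>\<^esub> Y) ` ?T = act h ` ?T"
    by (intro image_cong) (auto simp: act_eq_translation)
  also have "\<dots> = S" using sets.sets_into_space[OF S] by (intro act_image_eq_vimage) simp
  finally show "emeasure (distr \<mu> \<mu> (act h)) S = emeasure \<mu> S" .
qed simp

lemma AE_act:
  assumes "AE X in \<mu>. P X"
  shows "AE X in \<mu>. P (act h X)"
proof (rule AE_distrD[OF act_measurable])
  show "AE X in distr \<mu> \<mu> (act h). P X" using assms by (simp only: distr_act)
qed

lemma integral_act:
  fixes F :: "_ \<Rightarrow> 'b::{banach, second_countable_topology}"
  assumes [measurable]: "F \<in> borel_measurable \<mu>"
  shows "(LINT X|\<mu>. F (act h X)) = (LINT X|\<mu>. F X)"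
  using integral_distr[OF act_measurable assms, of h] by (simp add: distr_act)

subsection \<open>The representation on square-integrable functions\<close>

sublocale L2_representation \<mu> odometer_rep "\<lambda>h. inv\<^bsub>Heis\<^esub> h"
proof
  fix F and h assume F: "F \<in> L2 \<mu>"
  note [measurable] = L2_measurable[OF F]
  show UF: "odometer_rep h F \<in> L2 \<mu>"
  proof (rule L2_I)
    show "odometer_rep h F \<in> borel_measurable \<mu>" unfolding odometer_rep_def by measurable
    have "integrable (distr \<mu> \<mu> (act (inv\<^bsub>Heis\<^esub> h))) (\<lambda>X. (cmod (F X))\<^sup>2)"
      by (simp add: distr_act L2_norm_sq_integrable[OF F])
    then show "integrable \<mu> (\<lambda>X. (cmod (odometer_rep h F X))\<^sup>2)"
      unfolding odometer_rep_def by (subst (asm) integrable_distr_eq) measurable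
  qed
  fix G assume G: "G \<in> L2 \<mu>"
  note [measurable] = L2_measurable[OF G] L2_measurable[OF UF]
  have "L2_inner \<mu> (odometer_rep h F) G
    = (LINT X|\<mu>. odometer_rep h F (act h X) * cnj (G (act h X)))"
    unfolding L2_inner_def by (rule integral_act[symmetric]) measurable
  also have "\<dots> = L2_inner \<mu> F (odometer_rep (inv\<^bsub>Heis\<^esub> h) G)"
    unfolding L2_inner_def
    by (intro Bochner_Integration.integral_cong refl) (simp add: odometer_rep_def act_inv_act)
  finally show "L2_inner \<mu> (odometer_rep h F) G = L2_inner \<mu> F (odometer_rep (inv\<^bsub>Heis\<^esub> h) G)" .
qed

text \<open>This is the pullback of the functions on the finite group \<open>Heis Mod \<Gamma> n\<close>.\<close>

definition level :: "nat \<Rightarrow> ((nat \<Rightarrow> heis set) \<Rightarrow> complex) set" where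
  "level n = {F \<in> L2 \<mu>. \<exists>\<phi>. AE X in \<mu>. F X = \<phi> (X n)}"

lemma levelI: "F \<in> L2 \<mu> \<Longrightarrow> AE X in \<mu>. F X = \<phi> (X n) \<Longrightarrow> F \<in> level n"
  unfolding level_def by blast

lemma levelE:
  assumes "F \<in> level n"
  obtains \<phi> where "F \<in> L2 \<mu>" "AE X in \<mu>. F X = \<phi> (X n)"
  using assms unfolding level_def by blast

lemma level_base: "(\<lambda>X. \<phi> (X n)) \<in> level n"
  by (rule levelI[OF level_L2, where \<phi> = \<phi>]) simp

lemma level_subspace: "L2_subspace \<mu> (level n)"
  unfolding L2_subspace_def
proof (intro conjI ballI allI impI)
  show "level n \<subseteq> L2 \<mu>" by (auto simp: level_def)
  show "(\<lambda>X. 0) \<in> level n" using level_base[of "\<lambda>_. 0"] .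
next
  fix F G assume "F \<in> level n" "G \<in> level n"
  then obtain \<phi> \<psi> where F: "F \<in> L2 \<mu>" "AE X in \<mu>. F X = \<phi> (X n)" and G: "G \<in> L2 \<mu>" "AE X in \<mu>. G X = \<psi> (X n)"
    by (auto elim!: levelE)
  show "(\<lambda>x. F x + G x) \<in> level n"
  proof (rule levelI[where \<phi> = "\<lambda>C. \<phi> C + \<psi> C"])
    show "AE X in \<mu>. F X + G X = \<phi> (X n) + \<psi> (X n)" using F(2) G(2) by eventually_elim simp
  qed (use F G in auto)
next
  fix c F assume "F \<in> level n"
  then obtain \<phi> where F: "F \<in> L2 \<mu>" "AE X in \<mu>. F X = \<phi> (X n)" by (auto elim!: levelE)
  show "(\<lambda>x. c * F x) \<in> level n"
  proof (rule levelI[where \<phi> = "\<lambda>C. c * \<phi> C"])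
    show "AE X in \<mu>. c * F X = c * \<phi> (X n)" using F(2) by eventually_elim simp
  qed (use F in auto)
next
  fix F G assume "F \<in> level n" and G: "G \<in> L2 \<mu>" and eq: "AE X in \<mu>. F X = G X"
  then obtain \<phi> where F: "AE X in \<mu>. F X = \<phi> (X n)" by (auto elim!: levelE)
  show "G \<in> level n"
  proof (rule levelI[OF G, where \<phi> = \<phi>])
    show "AE X in \<mu>. G X = \<phi> (X n)" using F eq by eventually_elim simp
  qed
qed

lemma level_invariant: "L2_invariant odometer_rep (level n)"
  unfolding L2_invariant_def
proof (intro allI ballI)
  fix h F assume "F \<in> level n"
  then obtain \<phi> where F: "F \<in> L2 \<mu>" "AE X in \<mu>. F X = \<phi> (X n)" by (auto elim!: levelE)
  show "odometer_rep h F \<in> level n"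
  proof (rule levelI[where \<phi> = "\<lambda>C. \<phi> (inv\<^bsub>Heis\<^esub> h <#\<^bsub>Heis\<^esub> C)"])
    show "AE X in \<mu>. odometer_rep h F X = \<phi> (inv\<^bsub>Heis\<^esub> h <#\<^bsub>Heis\<^esub> X n)"
      using AE_act[OF F(2), of "inv\<^bsub>Heis\<^esub> h"] by (simp add: odometer_rep_def odometer_act_def)
  qed (rule U_L2[OF F(1)])
qed

text \<open>As \<open>\<Gamma> n\<close> is normal, it acts trivially on \<open>Heis Mod \<Gamma> n\<close> also by left multiplication.\<close>

lemma level_fixed:
  assumes F: "F \<in> level n" and h: "h \<in> \<Gamma> n"
  shows "AE X in \<mu>. odometer_rep h F X = F X"
proof -
  obtain \<phi> where \<phi>: "AE X in \<mu>. F X = \<phi> (X n)" using F by (auto elim!: levelE)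
  have inv: "inv\<^bsub>Heis\<^esub> h \<in> \<Gamma> n" using subgroup.m_inv_closed[OF subgroup h] .
  have "act (inv\<^bsub>Heis\<^esub> h) X n = X n" if X: "X \<in> \<Omega>" for X
  proof -
    obtain k where k: "X n = \<Gamma> n #>\<^bsub>Heis\<^esub> k" by (rule \<Omega>_rcosetE[OF X])
    have "act (inv\<^bsub>Heis\<^esub> h) X n = \<Gamma> n #>\<^bsub>Heis\<^esub> (inv\<^bsub>Heis\<^esub> h \<otimes>\<^bsub>Heis\<^esub> k)" by (rule act_level[where X = X and n = n and k = k, OF k])
    also have "\<dots> = (\<Gamma> n #>\<^bsub>Heis\<^esub> inv\<^bsub>Heis\<^esub> h) #>\<^bsub>Heis\<^esub> k"
      by (simp only: heis.coset_mult_assoc carrier_Heis UNIV_I subset_UNIV)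
    also have "\<Gamma> n #>\<^bsub>Heis\<^esub> inv\<^bsub>Heis\<^esub> h = \<Gamma> n" by (rule subgroup.rcos_const[OF subgroup group_Heis inv])
    finally show ?thesis using k by simp
  qed
  moreover have "AE X in \<mu>. X \<in> \<Omega>" by (rule AE_I2) simp
  ultimately show ?thesis
    using \<phi> AE_act[OF \<phi>, of "inv\<^bsub>Heis\<^esub> h"]
    by (auto simp: odometer_rep_def elim!: eventually_elim2)
qed

lemma level_mono: "i \<le> j \<Longrightarrow> level i \<subseteq> level j"
proof
  fix F assume ij: "i \<le> j" and "F \<in> level i"
  then obtain \<phi> where F: "F \<in> L2 \<mu>" "AE X in \<mu>. F X = \<phi> (X i)" by (auto elim!: levelE)
  show "F \<in> level j"
  proof (rule levelI[OF F(1), where \<phi> = "\<lambda>C. \<phi> (\<Gamma> i <#>\<^bsub>Heis\<^esub> C)"])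
    show "AE X in \<mu>. F X = \<phi> (\<Gamma> i <#>\<^bsub>Heis\<^esub> X j)"
      using F(2) AE_space by eventually_elim (simp flip: \<Omega>_projection[OF _ ij])
  qed
qed

lemma level_generated: "\<exists>k. L2_generated \<mu> (level n) k"
proof -
  obtain e where e: "bij_betw e {0..<card (rcosets\<^bsub>Heis\<^esub> (\<Gamma> n))} (rcosets\<^bsub>Heis\<^esub> (\<Gamma> n))"
    using ex_bij_betw_nat_finite[OF finite_rcosets] by blast
  let ?k = "card (rcosets\<^bsub>Heis\<^esub> (\<Gamma> n))"
  let ?b = "\<lambda>i X. if X n = e i then 1 else 0 :: complex"
  have "level n \<subseteq> L2_span \<mu> ?b ?k"
  proof
    fix F assume "F \<in> level n"
    then obtain \<phi> where F: "F \<in> L2 \<mu>" "AE X in \<mu>. F X = \<phi> (X n)" by (auto elim!: levelE)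
    show "F \<in> L2_span \<mu> ?b ?k"
    proof (rule L2_spanI[OF F(1), where c = "\<lambda>i. \<phi> (e i)"])
      show "AE X in \<mu>. F X = (\<Sum>i<?k. \<phi> (e i) * ?b i X)"
        using F(2) AE_space
      proof eventually_elim
        case (elim X)
        then have "X n \<in> e ` {0..<?k}" using \<Omega>_rcoset[of X n] e by (simp add: bij_betw_def)
        then obtain i where i: "i < ?k" "X n = e i" by auto
        have "\<phi> (e j) * ?b j X = (if j = i then \<phi> (e i) else 0)" if "j < ?k" for j
          using that i e inj_onD[of e "{0..<?k}" i j] by (auto simp: bij_betw_def)
        then have "(\<Sum>j<?k. \<phi> (e j) * ?b j X) = (\<Sum>j<?k. if j = i then \<phi> (e i) else 0)"
          by (intro sum.cong) auto
        then show ?case using i elim by simp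
      qed
    qed
  qed
  moreover have "?b i \<in> level n" for i
    by (rule level_base[where \<phi> = "\<lambda>C. if C = e i then 1 else 0"])
  ultimately show ?thesis unfolding L2_generated_def by (intro exI[of _ ?k] exI[of _ ?b]) simp
qed

lemma level_dense:
  assumes "F \<in> L2 \<mu>" "0 < \<epsilon>"
  shows "\<exists>n. \<exists>G\<in>level n. L2_norm \<mu> (\<lambda>X. F X - G X) < \<epsilon>"
proof (rule L2_dense_if_generating_indicators[OF finite_measure_axioms Int_stable_cylinders _ _ level_subspace level_mono _ _ assms])
  show "cylinders \<subseteq> Pow (space \<mu>)" "sets \<mu> = sigma_sets (space \<mu>) cylinders"
    using cylinders_subset sets_\<mu> by simp_all
  show "(\<lambda>X. 1) \<in> level 0" using level_base[of "\<lambda>_. 1"] .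
  fix S assume "S \<in> cylinders"
  then obtain n C where S: "S = cylinder n C" unfolding cylinders_def by blast
  have "indicator S \<in> level n"
  proof (rule levelI[where \<phi> = "\<lambda>D. if D = C then 1 else 0"])
    show "AE X in \<mu>. indicator S X = (if X n = C then 1 else 0 :: complex)"
      by (rule AE_I2) (simp add: S cylinder_def indicator_def)
    have "integrable \<mu> (indicator S :: _ \<Rightarrow> real)" by (simp add: S less_top[symmetric])
    moreover have "(\<lambda>x. (cmod (indicator S x))\<^sup>2) = (indicator S :: _ \<Rightarrow> real)"
      by (auto simp: indicator_def)
    ultimately show "indicator S \<in> L2 \<mu>" using S by (auto simp: L2_def)
  qed
  then show "\<exists>n. indicator S \<in> level n" by blast
qed

sublocale L2_exhausted_representation \<mu> odometer_rep "\<lambda>h. inv\<^bsub>Heis\<^esub> h" level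
  by unfold_locales
    (fact level_subspace level_invariant level_generated level_mono level_dense)+

end

section \<open>The finite-dimensional representations\<close>

definition circ :: "real \<Rightarrow> complex" where
  "circ t = exp (2 * pi * \<i> * complex_of_real t)"

lemma circ_eq_cis: "circ t = cis (2 * pi * t)"
  by (simp add: circ_def cis_conv_exp mult_ac)

lemma circ_add: "circ (s + t) = circ s * circ t"
  by (simp add: circ_eq_cis cis_mult distrib_left)

lemma cmod_circ [simp]: "cmod (circ t) = 1"
  by (simp add: circ_eq_cis)

lemma circ_nonzero [simp]: "circ t \<noteq> 0"
  using cmod_circ[of t] by force

lemma circ_eq_1_iff: "circ t = 1 \<longleftrightarrow> t \<in> \<int>"
proof -
  have "circ t = 1 \<longleftrightarrow> (\<exists>k::int. 2 * pi * t = of_int (2 * k) * pi)"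
    by (simp add: circ_def exp_eq_1)
  also have "\<dots> \<longleftrightarrow> (\<exists>k::int. t = of_int k)" by (simp add: mult_ac)
  finally show ?thesis by (auto simp: Ints_def)
qed

lemma circ_cong: "s - t \<in> \<int> \<Longrightarrow> circ s = circ t"
  using circ_add[of "s - t" t] circ_eq_1_iff[of "s - t"] by simp

lemma circ_power: "circ t ^ k = circ (real k * t)"
  by (induction k) (simp_all add: circ_add distrib_right circ_eq_1_iff)

lemma circ_mult_cnj: "circ t * cnj (circ t) = 1"
  using complex_norm_square[of "circ t"] by simp

lemma cvecs_add: "v \<in> cvecs p \<Longrightarrow> w \<in> cvecs p \<Longrightarrow> (\<lambda>j. v j + w j) \<in> cvecs p"
  and cvecs_scale: "v \<in> cvecs p \<Longrightarrow> (\<lambda>j. c * v j) \<in> cvecs p"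
  by (auto simp: cvecs_def)

definition unit_vec :: "nat \<Rightarrow> nat \<Rightarrow> complex" where
  "unit_vec i = (\<lambda>j. if j = i then 1 else 0)"

lemma unit_vec_cvecs: "i < p \<Longrightarrow> unit_vec i \<in> cvecs p"
  by (auto simp: unit_vec_def cvecs_def)

lemma cvecs_expand: "v \<in> cvecs p \<Longrightarrow> v = (\<lambda>j. \<Sum>i<p. v i * unit_vec i j)"
  by (auto simp: fun_eq_iff unit_vec_def cvecs_def if_distrib cong: if_cong)

locale heis_rep_parameters =
  fixes \<alpha> \<xi> :: real and l :: int and p :: nat
  assumes p_pos: "p \<ge> 1" and coprime: "coprime l (int p)"
begin

abbreviation \<rho> :: "heis \<Rightarrow> (nat \<Rightarrow> complex) \<Rightarrow> nat \<Rightarrow> complex" where "\<rho> \<equiv> heis_rep \<alpha> \<xi> l p"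

definition angle :: "heis \<Rightarrow> nat \<Rightarrow> real" where
  "angle = (\<lambda>(x, y, z) j. of_int y * \<xi> + of_int (z + int j * y) * (of_int l / of_nat p) +
     of_int ((x + int j) div int p) * \<alpha>)"

definition shift :: "int \<Rightarrow> nat \<Rightarrow> nat" where
  "shift x j = nat ((int j + x) mod int p)"

lemma int_shift: "int (shift x j) = (int j + x) mod int p"
  using p_pos by (simp add: shift_def)

lemma shift_less: "shift x j < p"
  using p_pos pos_mod_bound[of "int p" "int j + x"] int_shift[of x j] by linarith

lemma shift_shift: "shift x' (shift x j) = shift (x + x') j"
proof -
  have "int (shift x' (shift x j)) = int (shift (x + x') j)"
    by (simp add: int_shift mod_simps add_ac)
  then show ?thesis by (simp only: of_nat_eq_iff)
qed

lemma shift_0: "j < p \<Longrightarrow> shift 0 j = j"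
  by (simp add: shift_def)

lemma rho_eq: "\<rho> h v j = (if j < p then circ (angle h j) * v (shift (fst h) j) else 0)"
proof -
  have floor: "\<lfloor>of_int a / real p\<rfloor> = a div int p" for a
    using floor_divide_of_int_eq[of a "int p"] by simp
  obtain x y z where h: "h = (x, y, z)" by (cases h)
  show ?thesis
    unfolding heis_rep_def circ_def angle_def shift_def h prod.case fst_conv floor ..
qed

lemma rho_cvecs: "\<rho> h v \<in> cvecs p"
  by (simp add: cvecs_def rho_eq)

lemma rho_add: "\<rho> h (\<lambda>j. v j + w j) j = \<rho> h v j + \<rho> h w j"
  and rho_scale: "\<rho> h (\<lambda>j. c * v j) j = c * \<rho> h v j"
  by (simp_all add: rho_eq distrib_left)

text \<open>Up to integers, the angles satisfy the cocycle identity: division with remainder of \<open>j + x\<close>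
  by \<open>p\<close> accounts both for the exponent of \<open>\<alpha>\<close> and for the carry in the exponent of \<open>l / p\<close>.\<close>

lemma rho_mult: "\<rho> (h \<otimes>\<^bsub>Heis\<^esub> k) v = \<rho> h (\<rho> k v)"
proof
  fix j
  obtain x y z x' y' z' where h: "h = (x, y, z)" and k: "k = (x', y', z')" by (cases h, cases k)
  let ?q = "(x + int j) div int p"
  have j': "int (shift x j) = int j + x - int p * ?q"
    by (simp add: int_shift minus_div_mult_eq_mod[symmetric] algebra_simps)
  have div: "(x + x' + int j) div int p = ?q + (x' + int (shift x j)) div int p"
  proof -
    have eq: "x + x' + int j = (x' + int (shift x j)) + ?q * int p" by (simp add: j' algebra_simps)
    show ?thesis unfolding eq by (subst div_mult_self1) (use p_pos in auto)
  qed
  have "angle h j + angle k (shift x j) - angle (h \<otimes>\<^bsub>Heis\<^esub> k) j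
      = of_int ((int (shift x j) - int j - x) * y') * (of_int l / of_nat p)"
    unfolding h k angle_def mult_Heis prod.case div of_int_add
    by (simp add: algebra_simps diff_divide_distrib add_divide_distrib)
  also have "\<dots> = of_int (- ?q * y' * l)"
    using p_pos by (simp add: j')
  finally have "circ (angle h j) * circ (angle k (shift x j)) = circ (angle (h \<otimes>\<^bsub>Heis\<^esub> k) j)"
    unfolding circ_add[symmetric] by (intro circ_cong) (simp only: Ints_of_int)
  then show "\<rho> (h \<otimes>\<^bsub>Heis\<^esub> k) v j = \<rho> h (\<rho> k v) j"
    by (auto simp: rho_eq shift_less shift_shift h k mult.assoc)
qed

text \<open>Orthogonality of the characters of the integers modulo \<open>p\<close>; \<open>l\<close> is invertible modulo \<open>p\<close>, so
  that different \<open>i\<close> and \<open>j\<close> give a nontrivial root of unity.\<close>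

lemma root_power_sum:
  assumes "i < p" "j < p"
  shows "(\<Sum>k<p. circ (real k * (of_int (int j - int i) * (of_int l / of_nat p))))
    = (if i = j then of_nat p else 0)"
proof (cases "i = j")
  case False
  let ?t = "of_int (int j - int i) * (of_int l / real p) :: real"
  have "?t \<notin> \<int>"
  proof
    assume "?t \<in> \<int>"
    then obtain q :: int where "?t = of_int q" by (auto simp: Ints_def)
    then have "of_int ((int j - int i) * l) = (of_int (q * int p) :: real)"
      using p_pos by (simp add: field_simps)
    then have "(int j - int i) * l = q * int p" by (simp only: of_int_eq_iff)
    then have "int p dvd (int j - int i) * l" by simp
    then have "int p dvd int j - int i"
      using coprime by (simp add: coprime_commute coprime_dvd_mult_left_iff)
    then have "\<bar>int p\<bar> \<le> \<bar>int j - int i\<bar>" using False by (intro dvd_imp_le_int) auto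
    then show False using assms by simp
  qed
  then have ne: "circ ?t \<noteq> 1" by (simp add: circ_eq_1_iff)
  have "circ ?t ^ p = circ (of_int ((int j - int i) * l))"
    using p_pos by (simp add: circ_power)
  also have "\<dots> = 1" unfolding circ_eq_1_iff by (rule Ints_of_int)
  finally have "(\<Sum>k<p. circ ?t ^ k) = 0" using geometric_sum[OF ne, of p] by simp
  then show ?thesis using False by (simp add: circ_power)
qed (simp add: circ_def)

text \<open>Irreducibility: the operators of \<open>(0, k, 0)\<close> are diagonal with pairwise different characters
  on the coordinates, so averaging isolates a nonzero coordinate of a nonzero vector; the operators
  of \<open>(x, 0, 0)\<close> then move it to every other coordinate.\<close>

lemma rho_irreducible:
  assumes S: "S \<subseteq> cvecs p"
    and add: "\<And>v w. v \<in> S \<Longrightarrow> w \<in> S \<Longrightarrow> (\<lambda>j. v j + w j) \<in> S"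
    and scale: "\<And>c v. v \<in> S \<Longrightarrow> (\<lambda>j. c * v j) \<in> S"
    and inv: "\<And>h v. v \<in> S \<Longrightarrow> \<rho> h v \<in> S"
    and v: "v \<in> S" "v i \<noteq> 0"
  shows "S = cvecs p"
proof -
  have i: "i < p" using v S by (force simp: cvecs_def not_le[symmetric])
  have unscale: "u \<in> S" if "(\<lambda>j. c * u j) \<in> S" "c \<noteq> 0" for c u
  proof -
    have "(\<lambda>j. inverse c * (c * u j)) = u" using that(2) by (simp add: fun_eq_iff flip: mult.assoc)
    then show ?thesis using scale[OF that(1), of "inverse c"] by simp
  qed
  have zero: "(\<lambda>j. 0) \<in> S" using scale[OF v(1), of 0] by simp
  have sum: "(\<lambda>j. \<Sum>k\<in>K. f k j) \<in> S" if "\<And>k. k \<in> K \<Longrightarrow> f k \<in> S" for K :: "nat set" and f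
    using that by (induction K rule: infinite_finite_induct) (auto intro: add zero)
  let ?c = "\<lambda>k. circ (- (real k * (\<xi> + of_int (int i) * (of_int l / of_nat p))))"
  let ?w = "\<lambda>j. \<Sum>k<p. ?c k * \<rho> (0, int k, 0) v j"
  \<comment> \<open>\<open>?w\<close> is \<open>p\<close> times the projection of \<open>v\<close> to the eigenspace of coordinate \<open>i\<close>.\<close>
  have "?w j = v j * (\<Sum>k<p. circ (real k * (of_int (int j - int i) * (of_int l / of_nat p))))"
    if "j < p" for j
  proof -
    have "?c k * \<rho> (0, int k, 0) v j
      = v j * circ (real k * (of_int (int j - int i) * (of_int l / of_nat p)))" for k
    proof -
      have angle: "angle (0, int k, 0) j = real k * \<xi> + real k * (real j * (of_int l / of_nat p))"
        using that by (simp add: angle_def mult_ac)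
      have "?c k * \<rho> (0, int k, 0) v j = v j * (?c k * circ (angle (0, int k, 0) j))"
        using that by (simp add: rho_eq shift_0)
      also have "?c k * circ (angle (0, int k, 0) j)
        = circ (real k * (of_int (int j - int i) * (of_int l / of_nat p)))"
        unfolding circ_add[symmetric] angle by (simp add: algebra_simps diff_divide_distrib)
      finally show ?thesis .
    qed
    then show ?thesis by (simp add: sum_distrib_left)
  qed
  then have "?w j = (of_nat p * v i) * unit_vec i j" for j
    using root_power_sum[OF i] by (cases "j < p") (use i in \<open>auto simp: unit_vec_def rho_eq\<close>)
  then have w: "?w = (\<lambda>j. (of_nat p * v i) * unit_vec i j)" by auto
  have "?w \<in> S" by (intro sum scale inv v)
  then have "(\<lambda>j. (of_nat p * v i) * unit_vec i j) \<in> S" by (simp only: w)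
  then have unit_i: "unit_vec i \<in> S" by (rule unscale) (use v(2) p_pos in auto)
  have unit: "unit_vec k \<in> S" if k: "k < p" for k
  proof -
    let ?h = "(int i - int k, 0, 0)"
    have eq: "shift (int i - int k) j = i \<longleftrightarrow> j = k" if j: "j < p" for j
    proof
      assume "shift (int i - int k) j = i"
      then have "shift (int k - int i) (shift (int i - int k) j) = shift (int k - int i) i" by simp
      then have "shift 0 j = shift (int k - int i) i" by (simp add: shift_shift)
      moreover have "shift (int k - int i) i = k" using k by (simp add: shift_def)
      ultimately show "j = k" using shift_0[OF j] by simp
    qed (use i in \<open>simp add: shift_def\<close>)
    have "\<rho> ?h (unit_vec i) = (\<lambda>j. circ (angle ?h k) * unit_vec k j)"
      using k eq by (auto simp: fun_eq_iff rho_eq unit_vec_def)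
    then have "(\<lambda>j. circ (angle ?h k) * unit_vec k j) \<in> S" using inv[OF unit_i, of ?h] by simp
    then show ?thesis by (rule unscale) simp
  qed
  have "u \<in> S" if u: "u \<in> cvecs p" for u
    by (subst cvecs_expand[OF u]) (intro sum scale unit, simp)
  then show ?thesis using S by blast
qed

definition trivial_on :: "heis set \<Rightarrow> bool" where
  "trivial_on N \<longleftrightarrow> (\<forall>h\<in>N. \<forall>v\<in>cvecs p. \<rho> h v = v)"

end

section \<open>Occurrence in the odometer representation\<close>

locale heis_spectrum = heis_odometer_measure \<Gamma> \<mu> + heis_rep_parameters \<alpha> \<xi> l p
  for \<Gamma> :: "nat \<Rightarrow> heis set" and \<mu> :: "(nat \<Rightarrow> heis set) measure"
    and \<alpha> \<xi> :: real and l :: int and p :: nat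
begin

text \<open>For some \<open>n\<close> the irreducible \<open>V\<close> contains no nonzero vector orthogonal to \<open>level n\<close>, whence
  \<open>\<Gamma> n\<close> fixes \<open>V\<close> pointwise; the isometry \<open>T\<close> carries this back to the coordinate space.\<close>

lemma trivial_on_if_occurs:
  assumes V: "L2_irreducible \<mu> odometer_rep V"
    and equiv: "unitarily_equivalent \<mu> odometer_rep V p \<rho>"
  shows "\<exists>n. trivial_on (\<Gamma> n)"
proof -
  obtain n where n: "L2_trivial \<mu> (V \<inter> L2_complement \<mu> (level n))"
    using irreducible_meets_E[OF V] by blast
  obtain T where "\<forall>v\<in>cvecs p. T v \<in> V"
    and "\<forall>v\<in>cvecs p. \<forall>w\<in>cvecs p. AE X in \<mu>. T (\<lambda>j. v j + w j) X = T v X + T w X"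
    and "\<forall>c. \<forall>v\<in>cvecs p. AE X in \<mu>. T (\<lambda>j. c * v j) X = c * T v X"
    and "\<forall>v\<in>cvecs p. \<forall>w\<in>cvecs p. L2_inner \<mu> (T v) (T w) = (\<Sum>j<p. v j * cnj (w j))"
    and "\<forall>h. \<forall>v\<in>cvecs p. AE X in \<mu>. T (\<rho> h v) X = odometer_rep h (T v) X"
    using equiv unfolding unitarily_equivalent_def by blast
  note T = this(1)[rule_format] and T_add = this(2)[rule_format] and T_scale = this(3)[rule_format]
    and T_inner = this(4)[rule_format] and T_rho = spec[OF this(5), rule_format]
  have "\<rho> h v = v" if h: "h \<in> \<Gamma> n" and v: "v \<in> cvecs p" for h v
  proof -
    have fixed: "AE X in \<mu>. odometer_rep h (T v) X = T v X"
      using level_fixed[OF _ subgroup.m_inv_closed[OF subgroup h]]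
      by (rule irreducible_fixed_if_E_fixed[OF V n _ T[OF v]])
    define w where "w = (\<lambda>j. \<rho> h v j + (-1) * v j)"
    have neg: "(\<lambda>j. (-1) * v j) \<in> cvecs p" by (rule cvecs_scale[OF v])
    have w: "w \<in> cvecs p" unfolding w_def by (rule cvecs_add[OF rho_cvecs neg])
    have "AE X in \<mu>. T w X = 0"
      using fixed T_rho[OF v, of h] T_add[OF rho_cvecs[of h v] neg] T_scale[OF v, of "-1"]
      unfolding w_def by eventually_elim simp
    moreover have "T w \<in> L2 \<mu>" using T[OF w] V by (auto simp: L2_irreducible_def intro: L2_subspaceD)
    ultimately have "(\<Sum>j<p. w j * cnj (w j)) = 0"
      using T_inner[OF w w] L2_inner_self_eq_0_iff by metis
    also have "(\<Sum>j<p. w j * cnj (w j)) = of_real (\<Sum>j<p. (cmod (w j))\<^sup>2)"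
      unfolding of_real_sum complex_norm_square ..
    finally have "(\<Sum>j<p. (cmod (w j))\<^sup>2) = 0" by (simp only: of_real_eq_0_iff)
    then have "w j = 0" if "j < p" for j using that by (simp add: sum_nonneg_eq_0_iff)
    moreover have "w j = 0" if "\<not> j < p" for j using that w by (simp add: cvecs_def)
    ultimately have "w j = 0" for j by blast
    then show ?thesis by (simp add: w_def fun_eq_iff)
  qed
  then show ?thesis unfolding trivial_on_def by blast
qed

end

text \<open>Conversely, a representation that is trivial on \<open>\<Gamma> n\<close> is realised by its matrix coefficients
  \<open>h \<mapsto> (\<rho> (inv h) v) 0\<close>, which are functions on the quotient by \<open>\<Gamma> n\<close>.\<close>

locale heis_coefficients = heis_spectrum +
  fixes n :: nat
  assumes trivial: "trivial_on (\<Gamma> n)"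
begin

definition coset_coef :: "(nat \<Rightarrow> complex) \<Rightarrow> heis set \<Rightarrow> complex" where
  "coset_coef v C = of_real (sqrt (real p)) * \<rho> (inv\<^bsub>Heis\<^esub> (SOME h. h \<in> C)) v 0"

definition coef :: "(nat \<Rightarrow> complex) \<Rightarrow> (nat \<Rightarrow> heis set) \<Rightarrow> complex" where
  "coef v = (\<lambda>X. coset_coef v (X n))"

definition residue :: "heis set \<Rightarrow> nat" where
  "residue C = shift (- fst (SOME h. h \<in> C)) 0"

lemma coef_eq:
  assumes X: "X \<in> \<Omega>" and h: "h \<in> X n" and v: "v \<in> cvecs p"
  shows "coef v X = of_real (sqrt (real p)) * \<rho> (inv\<^bsub>Heis\<^esub> h) v 0"
proof -
  define k where "k = (SOME h. h \<in> X n)"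
  have "k \<in> X n" unfolding k_def using h by (rule someI)
  also have "X n = \<Gamma> n #>\<^bsub>Heis\<^esub> h" by (rule rcoset_eq_if_mem[OF \<Omega>_rcoset[OF X] h])
  finally obtain g where g: "g \<in> \<Gamma> n" "k = g \<otimes>\<^bsub>Heis\<^esub> h" unfolding r_coset_def by blast
  have "inv\<^bsub>Heis\<^esub> k = inv\<^bsub>Heis\<^esub> h \<otimes>\<^bsub>Heis\<^esub> inv\<^bsub>Heis\<^esub> g"
    unfolding g(2) by (rule heis.inv_mult_group) auto
  then have "\<rho> (inv\<^bsub>Heis\<^esub> k) v = \<rho> (inv\<^bsub>Heis\<^esub> h) (\<rho> (inv\<^bsub>Heis\<^esub> g) v)" by (simp only: rho_mult)
  also have "\<rho> (inv\<^bsub>Heis\<^esub> g) v = v"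
    using trivial subgroup.m_inv_closed[OF subgroup g(1)] v by (simp only: trivial_on_def)
  finally show ?thesis unfolding coef_def coset_coef_def k_def by simp
qed

lemma mem_component:
  assumes "X \<in> \<Omega>"
  obtains h where "h \<in> X m"
proof -
  obtain h where "X m = \<Gamma> m #>\<^bsub>Heis\<^esub> h" by (rule \<Omega>_rcosetE[OF assms])
  then show thesis using that[of h] mem_rcoset_self by simp
qed

lemma mem_act: "h \<in> X n \<Longrightarrow> k \<otimes>\<^bsub>Heis\<^esub> h \<in> act k X n"
  unfolding odometer_act_def l_coset_def by blast

lemma fst_mult: "fst (h \<otimes>\<^bsub>Heis\<^esub> k) = fst h + fst k"
  by (cases h, cases k) simp

lemma fst_inv: "fst (inv\<^bsub>Heis\<^esub> h) = - fst h"
  by (cases h) (simp add: inv_Heis)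

lemma residue_less: "residue C < p"
  unfolding residue_def by (rule shift_less)

text \<open>The coefficients of the unit vectors read off the residue, so it does not depend on the chosen
  representative.\<close>

lemma residue_eq:
  assumes X: "X \<in> \<Omega>" and h: "h \<in> X n"
  shows "residue (X n) = shift (- fst h) 0"
proof -
  let ?j = "residue (X n)"
  have "coef (unit_vec ?j) X \<noteq> 0"
    using p_pos by (simp add: coef_def coset_coef_def rho_eq fst_inv unit_vec_def residue_def)
  then have "unit_vec ?j (shift (- fst h) 0) \<noteq> 0"
    using coef_eq[OF X h unit_vec_cvecs[OF residue_less]] by (auto simp: rho_eq fst_inv split: if_splits)
  then show ?thesis by (auto simp: unit_vec_def split: if_splits)
qed

lemma residue_act:
  assumes X: "X \<in> \<Omega>"
  shows "residue (act (- j, 0, 0) X n) = shift j (residue (X n))"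
proof -
  obtain h where h: "h \<in> X n" by (rule mem_component[OF X])
  show ?thesis
    unfolding residue_eq[OF X h] residue_eq[OF act_\<Omega>[OF X] mem_act[where X = X and h = h, OF h]] fst_mult
    by (simp add: shift_shift)
qed

text \<open>Averaging over the translations by \<open>(- j, 0, 0)\<close>, which permute the residues cyclically.\<close>

lemma integral_residue:
  fixes f :: "nat \<Rightarrow> complex"
  shows "of_nat p * (LINT X|\<mu>. f (residue (X n))) = (\<Sum>j<p. f j)"
proof -
  have meas: "(\<lambda>X. f (residue (X n))) \<in> borel_measurable \<mu>"
    by (rule level_measurable[where \<phi> = "\<lambda>C. f (residue C)"])
  have shifted: "(LINT X|\<mu>. f (shift (int j) (residue (X n)))) = (LINT X|\<mu>. f (residue (X n)))" for j
  proof -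
    have "(LINT X|\<mu>. f (shift (int j) (residue (X n))))
      = (LINT X|\<mu>. f (residue (act (- int j, 0, 0) X n)))"
      by (intro Bochner_Integration.integral_cong refl) (simp add: residue_act)
    also have "\<dots> = (LINT X|\<mu>. f (residue (X n)))" by (rule integral_act[OF meas])
    finally show ?thesis .
  qed
  have int: "integrable \<mu> (\<lambda>X. f (shift (int j) (residue (X n))))" for j
  proof (rule integrable_const_bound)
    show "AE X in \<mu>. norm (f (shift (int j) (residue (X n)))) \<le> (\<Sum>i<p. norm (f i))"
      by (intro AE_I2 member_le_sum) (auto simp: shift_less)
    show "(\<lambda>X. f (shift (int j) (residue (X n)))) \<in> borel_measurable \<mu>"
      by (rule level_measurable[where \<phi> = "\<lambda>C. f (shift (int j) (residue C))"])
  qed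
  have all: "(\<Sum>j<p. f (shift (int j) r)) = (\<Sum>j<p. f j)" if "r < p" for r
  proof -
    have inj: "inj_on (\<lambda>j. shift (int j) r) {..<p}"
    proof (rule inj_on_inverseI)
      fix j assume "j \<in> {..<p}"
      then show "shift (- int r) (shift (int j) r) = j" by (simp add: shift_shift) (simp add: shift_def)
    qed
    have "(\<lambda>j. shift (int j) r) ` {..<p} \<subseteq> {..<p}" by (auto simp: shift_less)
    with inj have "bij_betw (\<lambda>j. shift (int j) r) {..<p} {..<p}"
      by (simp add: bij_betw_def endo_inj_surj)
    then show ?thesis by (rule sum.reindex_bij_betw)
  qed
  have "of_nat p * (LINT X|\<mu>. f (residue (X n))) = (\<Sum>j<p. (LINT X|\<mu>. f (shift (int j) (residue (X n)))))"
    by (simp only: shifted) simp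
  also have "\<dots> = (LINT X|\<mu>. (\<Sum>j<p. f (shift (int j) (residue (X n)))))"
    by (rule Bochner_Integration.integral_sum[symmetric]) (rule int)
  also have "\<dots> = (\<Sum>j<p. f j)"
    by (simp only: all[OF residue_less]) (simp add: prob_space[simplified])
  finally show ?thesis .
qed

text \<open>Both factors of \<open>coef v X * cnj (coef w X)\<close> carry the same phase, which cancels.\<close>

lemma coef_inner: "L2_inner \<mu> (coef v) (coef w) = (\<Sum>j<p. v j * cnj (w j))"
proof -
  have "coef v X * cnj (coef w X) = of_nat p * (v (residue (X n)) * cnj (w (residue (X n))))" for X
  proof -
    let ?h = "inv\<^bsub>Heis\<^esub> (SOME h. h \<in> X n)"
    let ?r = "residue (X n)"
    have "coef u X = of_real (sqrt (real p)) * (circ (angle ?h 0) * u ?r)" for u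
      using p_pos by (simp add: coef_def coset_coef_def rho_eq fst_inv residue_def)
    then have "coef v X * cnj (coef w X)
      = (of_real (sqrt (real p)) * of_real (sqrt (real p))) * (circ (angle ?h 0) * cnj (circ (angle ?h 0)))
        * (v ?r * cnj (w ?r))"
      by simp
    also have "of_real (sqrt (real p)) * of_real (sqrt (real p)) = (of_nat p :: complex)"
      by (simp flip: of_real_mult)
    finally show ?thesis by (simp only: circ_mult_cnj mult_1_right)
  qed
  then have "L2_inner \<mu> (coef v) (coef w)
      = of_nat p * (LINT X|\<mu>. v (residue (X n)) * cnj (w (residue (X n))))"
    by (simp add: L2_inner_def)
  also have "\<dots> = (\<Sum>j<p. v j * cnj (w j))"
    by (rule integral_residue[where f = "\<lambda>j. v j * cnj (w j)"])
  finally show ?thesis .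
qed

text \<open>\<open>inv (inv k * h) = inv h * k\<close>, so translating the argument by \<open>inv k\<close> applies \<open>\<rho> k\<close> to \<open>v\<close>.\<close>

lemma coef_rho:
  assumes X: "X \<in> \<Omega>" and v: "v \<in> cvecs p"
  shows "coef (\<rho> k v) X = odometer_rep k (coef v) X"
proof -
  obtain h where h: "h \<in> X n" by (rule mem_component[OF X])
  have "odometer_rep k (coef v) X
      = of_real (sqrt (real p)) * \<rho> (inv\<^bsub>Heis\<^esub> (inv\<^bsub>Heis\<^esub> k \<otimes>\<^bsub>Heis\<^esub> h)) v 0"
    unfolding odometer_rep_def by (rule coef_eq[OF act_\<Omega>[OF X] mem_act[where X = X and h = h, OF h] v])
  also have "inv\<^bsub>Heis\<^esub> (inv\<^bsub>Heis\<^esub> k \<otimes>\<^bsub>Heis\<^esub> h) = inv\<^bsub>Heis\<^esub> h \<otimes>\<^bsub>Heis\<^esub> k"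
    using heis.inv_mult_group[of "inv\<^bsub>Heis\<^esub> k" h] heis.inv_inv[of k] by (simp del: split_paired_All)
  also have "\<rho> (inv\<^bsub>Heis\<^esub> h \<otimes>\<^bsub>Heis\<^esub> k) v = \<rho> (inv\<^bsub>Heis\<^esub> h) (\<rho> k v)" by (rule rho_mult)
  finally show ?thesis using coef_eq[OF X h rho_cvecs] by simp
qed

lemma coef_add: "coef (\<lambda>j. v j + w j) X = coef v X + coef w X"
  and coef_scale: "coef (\<lambda>j. c * v j) X = c * coef v X"
  by (simp_all add: coef_def coset_coef_def rho_add rho_scale distrib_left)

lemma coef_sum: "coef (\<lambda>j. \<Sum>i\<in>I. f i j) X = (\<Sum>i\<in>I. coef (f i) X)"
proof (induction I rule: infinite_finite_induct)
  case (insert i I)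
  then show ?case using coef_add[of "f i" "\<lambda>j. \<Sum>i\<in>I. f i j"] by simp
qed (use coef_scale[of 0 "\<lambda>_. 0"] in simp_all)

lemma coef_L2: "coef v \<in> L2 \<mu>"
  unfolding coef_def by (rule level_L2)

definition coef_space :: "((nat \<Rightarrow> heis set) \<Rightarrow> complex) set" where
  "coef_space = {F \<in> L2 \<mu>. \<exists>v\<in>cvecs p. AE X in \<mu>. F X = coef v X}"

lemma coef_spaceI: "F \<in> L2 \<mu> \<Longrightarrow> v \<in> cvecs p \<Longrightarrow> AE X in \<mu>. F X = coef v X \<Longrightarrow> F \<in> coef_space"
  unfolding coef_space_def by blast

lemma coef_spaceE:
  assumes "F \<in> coef_space"
  obtains v where "F \<in> L2 \<mu>" "v \<in> cvecs p" "AE X in \<mu>. F X = coef v X"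
  using assms unfolding coef_space_def by blast

lemma coef_mem: "v \<in> cvecs p \<Longrightarrow> coef v \<in> coef_space"
  by (rule coef_spaceI[OF coef_L2]) auto

lemma coef_space_subspace: "L2_subspace \<mu> coef_space"
  unfolding L2_subspace_def
proof (intro conjI ballI allI impI)
  show "coef_space \<subseteq> L2 \<mu>" by (auto simp: coef_space_def)
  show "(\<lambda>X. 0) \<in> coef_space"
  proof (rule coef_spaceI[where v = "\<lambda>_. 0"])
    show "AE X in \<mu>. 0 = coef (\<lambda>_. 0) X" using coef_scale[of 0 "\<lambda>_. 0"] by simp
  qed (auto simp: cvecs_def)
next
  fix F G assume "F \<in> coef_space" "G \<in> coef_space"
  then obtain v w where F: "F \<in> L2 \<mu>" "v \<in> cvecs p" "AE X in \<mu>. F X = coef v X"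
    and G: "G \<in> L2 \<mu>" "w \<in> cvecs p" "AE X in \<mu>. G X = coef w X"
    by (auto elim!: coef_spaceE)
  show "(\<lambda>X. F X + G X) \<in> coef_space"
  proof (rule coef_spaceI[OF L2_add[OF F(1) G(1)] cvecs_add[OF F(2) G(2)]])
    show "AE X in \<mu>. F X + G X = coef (\<lambda>j. v j + w j) X"
      using F(3) G(3) by eventually_elim (simp add: coef_add)
  qed
next
  fix c F assume "F \<in> coef_space"
  then obtain v where F: "F \<in> L2 \<mu>" "v \<in> cvecs p" "AE X in \<mu>. F X = coef v X"
    by (auto elim!: coef_spaceE)
  show "(\<lambda>X. c * F X) \<in> coef_space"
  proof (rule coef_spaceI[OF L2_scale[OF F(1)] cvecs_scale[OF F(2)]])
    show "AE X in \<mu>. c * F X = coef (\<lambda>j. c * v j) X"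
      using F(3) by eventually_elim (simp add: coef_scale)
  qed
next
  fix F G assume "F \<in> coef_space" and G: "G \<in> L2 \<mu>" and eq: "AE X in \<mu>. F X = G X"
  then obtain v where F: "v \<in> cvecs p" "AE X in \<mu>. F X = coef v X" by (auto elim!: coef_spaceE)
  show "G \<in> coef_space"
  proof (rule coef_spaceI[OF G F(1)])
    show "AE X in \<mu>. G X = coef v X" using F(2) eq by eventually_elim simp
  qed
qed

lemma coef_space_invariant: "L2_invariant odometer_rep coef_space"
  unfolding L2_invariant_def
proof (intro allI ballI)
  fix h F assume "F \<in> coef_space"
  then obtain v where F: "F \<in> L2 \<mu>" "v \<in> cvecs p" "AE X in \<mu>. F X = coef v X"
    by (auto elim!: coef_spaceE)
  show "odometer_rep h F \<in> coef_space"
  proof (rule coef_spaceI[OF U_L2[OF F(1)] rho_cvecs])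
    show "AE X in \<mu>. odometer_rep h F X = coef (\<rho> h v) X"
      using AE_act[OF F(3), of "inv\<^bsub>Heis\<^esub> h"] AE_space
      by eventually_elim (simp add: coef_rho[OF _ F(2)] odometer_rep_def)
  qed
qed

lemma coef_space_generated: "L2_generated \<mu> coef_space p"
  unfolding L2_generated_def
proof (intro exI[of _ "\<lambda>i. coef (unit_vec i)"] conjI allI impI subsetI)
  fix F assume "F \<in> coef_space"
  then obtain v where F: "F \<in> L2 \<mu>" "v \<in> cvecs p" "AE X in \<mu>. F X = coef v X"
    by (auto elim!: coef_spaceE)
  have "coef v X = (\<Sum>i<p. v i * coef (unit_vec i) X)" for X
    by (subst cvecs_expand[OF F(2)]) (simp only: coef_sum coef_scale)
  then show "F \<in> L2_span \<mu> (\<lambda>i. coef (unit_vec i)) p"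
    using F by (intro L2_spanI[where c = v]) auto
qed (rule coef_mem[OF unit_vec_cvecs])

lemma coef_space_nontrivial: "\<not> L2_trivial \<mu> coef_space"
proof
  assume "L2_trivial \<mu> coef_space"
  then have "AE X in \<mu>. coef (unit_vec 0) X = 0"
    using coef_mem[OF unit_vec_cvecs, of 0] p_pos by (simp add: L2_trivial_def)
  then have "L2_inner \<mu> (coef (unit_vec 0)) (coef (unit_vec 0)) = 0"
    using L2_inner_self_eq_0_iff[OF coef_L2] by blast
  then show False
    using p_pos unfolding coef_inner by (simp add: unit_vec_def if_distrib cong: if_cong)
qed

text \<open>The vectors with coefficients in an invariant subspace \<open>W\<close> satisfy the hypotheses of
  \<open>rho_irreducible\<close>.\<close>

lemma coef_space_irreducible: "L2_irreducible \<mu> odometer_rep coef_space"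
  unfolding L2_irreducible_def
proof (intro conjI allI impI)
  fix W assume "L2_subspace \<mu> W \<and> L2_invariant odometer_rep W \<and> W \<subseteq> coef_space"
  then have W: "L2_subspace \<mu> W" "L2_invariant odometer_rep W" "W \<subseteq> coef_space" by auto
  have "W = coef_space" if "\<not> L2_trivial \<mu> W"
  proof -
    define S where "S = {v \<in> cvecs p. coef v \<in> W}"
    have mem: "v \<in> S" if "F \<in> W" "v \<in> cvecs p" "AE X in \<mu>. F X = coef v X" for F v
      using that L2_subspace_AE[OF W(1) _ coef_L2] by (simp add: S_def)
    obtain F where F: "F \<in> W" "\<not> (AE X in \<mu>. F X = 0)"
      using \<open>\<not> L2_trivial \<mu> W\<close> unfolding L2_trivial_def by blast
    then obtain v where v: "v \<in> cvecs p" "AE X in \<mu>. F X = coef v X"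
      using W(3) by (blast elim: coef_spaceE)
    have "\<exists>i. v i \<noteq> 0"
    proof (rule ccontr)
      assume "\<nexists>i. v i \<noteq> 0"
      then have "v = (\<lambda>j. 0 * v j)" by auto
      then have "coef v X = 0" for X using coef_scale[of 0 v X] by simp
      then show False using F(2) v(2) by simp
    qed
    then obtain i where i: "v i \<noteq> 0" by blast
    have "S = cvecs p"
    proof (rule rho_irreducible[OF _ _ _ _ mem[OF F(1) v] i])
      show "S \<subseteq> cvecs p" by (auto simp: S_def)
      show "(\<lambda>j. v j + w j) \<in> S" if "v \<in> S" "w \<in> S" for v w
        using that L2_subspace_add[OF W(1), of "coef v" "coef w"] cvecs_add
        by (auto simp: S_def coef_add[abs_def])
      show "(\<lambda>j. c * v j) \<in> S" if "v \<in> S" for c v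
        using that L2_subspace_scale[OF W(1), of "coef v" c] cvecs_scale
        by (auto simp: S_def coef_scale[abs_def])
      show "\<rho> h v \<in> S" if "v \<in> S" for h v
      proof (rule mem)
        show "odometer_rep h (coef v) \<in> W" using that W(2) unfolding S_def L2_invariant_def by blast
        show "AE X in \<mu>. odometer_rep h (coef v) X = coef (\<rho> h v) X"
          using that by (intro AE_I2) (simp add: S_def coef_rho)
      qed (rule rho_cvecs)
    qed
    have "F \<in> W" if "F \<in> coef_space" for F
    proof -
      obtain v where v: "F \<in> L2 \<mu>" "v \<in> cvecs p" "AE X in \<mu>. F X = coef v X"
        using \<open>F \<in> coef_space\<close> by (blast elim: coef_spaceE)
      then have "coef v \<in> W" using \<open>S = cvecs p\<close> by (auto simp: S_def)
      moreover have "AE X in \<mu>. coef v X = F X" using v(3) by eventually_elim simp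
      ultimately show ?thesis using v(1) L2_subspace_AE[OF W(1)] by blast
    qed
    then show ?thesis using W(3) by blast
  qed
  then show "L2_trivial \<mu> W \<or> W = coef_space" by blast
qed (rule coef_space_subspace coef_space_invariant coef_space_nontrivial)+

lemma coef_space_equivalent: "unitarily_equivalent \<mu> odometer_rep coef_space p \<rho>"
  unfolding unitarily_equivalent_def
  by (intro exI[of _ coef] conjI allI ballI)
    (auto simp: coef_mem coef_add coef_scale coef_inner coef_rho intro!: AE_I2 elim: coef_spaceE)

lemma coef_space_level: "coef_space \<subseteq> level n"
proof
  fix F assume "F \<in> coef_space"
  then obtain v where "F \<in> L2 \<mu>" "AE X in \<mu>. F X = coset_coef v (X n)"
    by (auto elim!: coef_spaceE simp: coef_def)
  then show "F \<in> level n" by (rule levelI)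
qed

text \<open>The coefficient space is placed below the levels from \<open>n\<close> on, which contain it, so that it is
  itself a summand of the decomposition.\<close>

lemma occurs: "in_odometer_spectrum \<mu> \<alpha> \<xi> l p"
proof -
  define E where "E k = (case k of 0 \<Rightarrow> coef_space | Suc k \<Rightarrow> level (n + k))" for k
  interpret E: L2_exhausted_representation \<mu> odometer_rep "\<lambda>h. inv\<^bsub>Heis\<^esub> h" E
  proof unfold_locales
    fix k
    show "L2_subspace \<mu> (E k)" "L2_invariant odometer_rep (E k)" "\<exists>j. L2_generated \<mu> (E k) j"
      using coef_space_subspace coef_space_invariant coef_space_generated
        level_subspace level_invariant level_generated
      by (auto simp: E_def split: nat.split)
  next
    fix i j :: nat assume "i \<le> j"
    then consider "i = j" | k where "i = 0" "j = Suc k" | h k where "i = Suc h" "j = Suc k" "h \<le> k"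
      by (cases i; cases j) auto
    then show "E i \<subseteq> E j"
    proof cases
      case 2
      then show ?thesis using coef_space_level level_mono[of n "n + k"] by (simp add: E_def)
    next
      case 3
      then show ?thesis using level_mono[of "n + h" "n + k"] by (simp add: E_def)
    qed simp
  next
    fix F and \<epsilon> :: real assume "F \<in> L2 \<mu>" "0 < \<epsilon>"
    then obtain m G where G: "G \<in> level m" "L2_norm \<mu> (\<lambda>X. F X - G X) < \<epsilon>"
      using level_dense by blast
    have "G \<in> E (Suc m)" using G(1) level_mono[of m "n + m"] by (auto simp: E_def)
    then show "\<exists>k. \<exists>G\<in>E k. L2_norm \<mu> (\<lambda>X. F X - G X) < \<epsilon>" using G(2) by blast
  qed
  have "decomposes {coef_space} (E 0)"
    unfolding decomposes_def
    using L2_finite_dim_if_generated[OF coef_space_generated] coef_space_irreducible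
      L2_sums_base[of coef_space "{coef_space}" \<mu>]
    by (auto simp: E_def)
  then obtain \<V> where "coef_space \<in> \<V>" "L2_decomposition \<mu> odometer_rep \<V>"
    using E.decomposition_from_first by blast
  then show ?thesis
    unfolding in_odometer_spectrum_def using coef_space_equivalent by blast
qed

end

context heis_spectrum
begin

theorem in_spectrum_iff_trivial_on: "in_odometer_spectrum \<mu> \<alpha> \<xi> l p \<longleftrightarrow> (\<exists>n. trivial_on (\<Gamma> n))"
proof
  assume "in_odometer_spectrum \<mu> \<alpha> \<xi> l p"
  then obtain \<V> V where "L2_decomposition \<mu> odometer_rep \<V>" "V \<in> \<V>"
    and equiv: "unitarily_equivalent \<mu> odometer_rep V p \<rho>"
    unfolding in_odometer_spectrum_def by blast
  then have "L2_irreducible \<mu> odometer_rep V" unfolding L2_decomposition_def by simp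
  then show "\<exists>n. trivial_on (\<Gamma> n)" using equiv by (rule trivial_on_if_occurs)
next
  assume "\<exists>n. trivial_on (\<Gamma> n)"
  then obtain n where "trivial_on (\<Gamma> n)" by blast
  then interpret heis_coefficients \<Gamma> \<mu> \<alpha> \<xi> l p n by unfold_locales
  show "in_odometer_spectrum \<mu> \<alpha> \<xi> l p" by (rule occurs)
qed

end

section \<open>The arithmetic criterion\<close>

text \<open>\<open>(0, 0, y)\<close> and \<open>(0, 0, x)\<close> are, up to inversion, the commutators of \<open>(x, y, z)\<close> with the two
  generators \<open>(1, 0, 0)\<close> and \<open>(0, 1, 0)\<close>.\<close>

lemma normal_Heis_center:
  assumes N: "N \<lhd> Heis" and h: "(x, y, z) \<in> N"
  shows "(0, 0, x) \<in> N" "(0, 0, y) \<in> N"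
proof -
  note closed = subgroup.m_closed[OF normal_imp_subgroup[OF N]]
    and inv_closed = subgroup.m_inv_closed[OF normal_imp_subgroup[OF N]]
  have "(1, 0, 0) \<otimes>\<^bsub>Heis\<^esub> (x, y, z) \<otimes>\<^bsub>Heis\<^esub> inv\<^bsub>Heis\<^esub> (1, 0, 0) \<in> N"
    "inv\<^bsub>Heis\<^esub> ((0, 1, 0) \<otimes>\<^bsub>Heis\<^esub> (x, y, z) \<otimes>\<^bsub>Heis\<^esub> inv\<^bsub>Heis\<^esub> (0, 1, 0)) \<in> N"
    using normal.inv_op_closed2[OF N _ h, of "(1, 0, 0)"]
      inv_closed[OF normal.inv_op_closed2[OF N _ h, of "(0, 1, 0)"]]
    by (simp_all only: carrier_Heis UNIV_I simp_thms)
  then have "(x, y, z + y) \<in> N" "(- x, - y, x * y - (z - x)) \<in> N"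
    by (simp_all add: inv_Heis algebra_simps)
  then show "(0, 0, x) \<in> N" "(0, 0, y) \<in> N"
    using closed[OF _ inv_closed[OF h], of "(x, y, z + y)"] closed[OF h, of "(- x, - y, x * y - (z - x))"]
    by (simp_all add: inv_Heis)
qed

text \<open>The central elements of \<open>N\<close> form a nonzero subgroup of the integers, because infinitely many
  central elements share finitely many cosets; its positive generator is its index.\<close>

lemma center_index:
  assumes N: "N \<lhd> Heis" and fin: "finite (rcosets\<^bsub>Heis\<^esub> N)"
    and m: "m = card (rcosets\<^bsub>Heis\<lparr>carrier := range heis_f\<rparr>\<^esub> (N \<inter> range heis_f))"
  shows "m > 0" and "(0, 0, z) \<in> N \<longleftrightarrow> int m dvd z"
proof -
  note sub = normal_imp_subgroup[OF N]
  note closed = subgroup.m_closed[OF sub] and inv_closed = subgroup.m_inv_closed[OF sub]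
  have add: "(0, 0, a + b) \<in> N" if "(0, 0, a) \<in> N" "(0, 0, b) \<in> N" for a b
    using closed[OF that] by simp
  have neg: "(0, 0, - a) \<in> N" if "(0, 0, a) \<in> N" for a
    using inv_closed[OF that] by (simp add: inv_Heis)
  have mult_nat: "(0, 0, int k * a) \<in> N" if a: "(0, 0, a) \<in> N" for k a
  proof (induction k)
    case 0
    then show ?case using subgroup.one_closed[OF sub] by simp
  next
    case (Suc k)
    then show ?case using add[OF a Suc] by (simp add: algebra_simps)
  qed
  have mult: "(0, 0, k * a) \<in> N" if a: "(0, 0, a) \<in> N" for k a
  proof (cases "k \<ge> 0")
    case True
    then show ?thesis using mult_nat[OF a, of "nat k"] by simp
  next
    case False
    then show ?thesis using neg[OF mult_nat[OF a, of "nat (- k)"]] by simp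
  qed
  define P where "P d \<longleftrightarrow> d > 0 \<and> (0, 0, int d) \<in> N" for d :: nat
  have "\<exists>d. P d"
  proof -
    have "(\<lambda>a::int. N #>\<^bsub>Heis\<^esub> (0, 0, a)) ` UNIV \<subseteq> rcosets\<^bsub>Heis\<^esub> N"
      by (auto intro: heis.rcosetsI)
    then have "finite ((\<lambda>a::int. N #>\<^bsub>Heis\<^esub> (0, 0, a)) ` UNIV)" using fin finite_subset by blast
    then have "\<not> inj (\<lambda>a::int. N #>\<^bsub>Heis\<^esub> (0, 0, a))"
      using finite_imageD infinite_UNIV_int by blast
    then obtain a b :: int where ab: "N #>\<^bsub>Heis\<^esub> (0, 0, a) = N #>\<^bsub>Heis\<^esub> (0, 0, b)" "a < b"
      by (auto simp: inj_def) (metis linorder_neqE)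
    have "(0, 0, b) \<in> N #>\<^bsub>Heis\<^esub> (0, 0, a)"
      unfolding ab(1) using heis.rcos_self[OF _ sub] by simp
    then have "(0, 0, b - a) \<in> N" by (auto simp: r_coset_def)
    then have "P (nat (b - a))" using ab(2) by (simp add: P_def)
    then show ?thesis by blast
  qed
  then obtain d where d: "P d" and least: "\<And>e. P e \<Longrightarrow> d \<le> e"
    using LeastI_ex[of P] Least_le[of P] by blast
  have d_pos: "d > 0" using d by (simp add: P_def)
  have mem_iff: "(0, 0, z) \<in> N \<longleftrightarrow> int d dvd z" for z
  proof
    assume z: "(0, 0, z) \<in> N"
    have "(0, 0, - (z div int d) * int d) \<in> N" using d by (intro mult) (simp add: P_def)
    from add[OF z this] have r: "(0, 0, z mod int d) \<in> N"
      by (simp add: minus_div_mult_eq_mod[symmetric])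
    show "int d dvd z"
    proof (rule ccontr)
      assume "\<not> int d dvd z"
      then have "z mod int d \<noteq> 0" by (simp only: dvd_eq_mod_eq_0 not_False_eq_True)
      moreover have "z mod int d \<ge> 0" using d_pos by simp
      ultimately have "z mod int d > 0" by linarith
      then have "P (nat (z mod int d))" using r by (simp add: P_def)
      then have "d \<le> nat (z mod int d)" by (rule least)
      then have "int d \<le> z mod int d" using \<open>z mod int d > 0\<close> by linarith
      moreover have "z mod int d < int d" using d_pos by (intro pos_mod_bound) simp
      ultimately show False by linarith
    qed
  next
    assume "int d dvd z"
    then show "(0, 0, z) \<in> N" using mult[of "int d" "z div int d"] d by (simp add: P_def)
  qed
  define c where "c z = {(0 :: int, 0 :: int, w) | w. int d dvd w - z}" for z
  have coset: "(N \<inter> range heis_f) #>\<^bsub>Heis\<^esub> heis_f z = c z" for z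
  proof -
    have "(N \<inter> range heis_f) #>\<^bsub>Heis\<^esub> heis_f z = {(0, 0, a + z) | a. int d dvd a}"
    proof -
      have "N \<inter> range heis_f = heis_f ` {a. int d dvd a}" by (auto simp: heis_f_def mem_iff)
      then show ?thesis by (auto simp: r_coset_def heis_f_def)
    qed
    also have "\<dots> = c z" unfolding c_def by (auto simp: algebra_simps)
    finally show ?thesis .
  qed
  have c_mod: "c (z mod int d) = c z" for z
  proof -
    have "int d dvd w - z mod int d \<longleftrightarrow> int d dvd w - z" for w
      by (simp add: mod_eq_dvd_iff[symmetric])
    then show ?thesis by (simp add: c_def)
  qed
  have "rcosets\<^bsub>Heis\<lparr>carrier := range heis_f\<rparr>\<^esub> (N \<inter> range heis_f) = range c"
    by (auto simp: RCOSETS_def coset)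
  also have "\<dots> = c ` {0..<int d}"
  proof
    show "range c \<subseteq> c ` {0..<int d}"
    proof
      fix S assume "S \<in> range c"
      then obtain z where "S = c (z mod int d)" using c_mod by auto
      then show "S \<in> c ` {0..<int d}" using d_pos by (intro image_eqI[of _ _ "z mod int d"]) auto
    qed
  qed auto
  finally have "m = card (c ` {0..<int d})" using m by simp
  also have "\<dots> = card {0..<int d}"
  proof (rule card_image, rule inj_onI)
    fix a b assume ab: "a \<in> {0..<int d}" "b \<in> {0..<int d}" "c a = c b"
    then have "(0, 0, a) \<in> c b" unfolding ab(3)[symmetric] by (simp add: c_def)
    then have "int d dvd a - b" by (simp add: c_def)
    then have "a mod int d = b mod int d" by (simp add: mod_eq_dvd_iff)
    then show "a = b" using ab by simp
  qed
  finally have "m = d" by simp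
  then show "m > 0" "(0, 0, z) \<in> N \<longleftrightarrow> int m dvd z" using d_pos mem_iff by auto
qed

text \<open>The fibre of \<open>N\<close> over \<open>(x, y)\<close> is invariant under adding \<open>m\<close>, so it has nonnegative elements
  and the least one in the definition of \<open>i\<close> exists.\<close>

lemma heis_triple_section:
  assumes N: "N \<lhd> Heis" and fin: "finite (rcosets\<^bsub>Heis\<^esub> N)" and triple: "heis_triple N A m i"
    and xy: "vector [x, y] \<in> range (\<lambda>w. A *v w)"
  shows "(x, y, i x y) \<in> N"
proof -
  note closed = subgroup.m_closed[OF normal_imp_subgroup[OF N]]
  have m: "m > 0" "\<And>z. (0, 0, z) \<in> N \<longleftrightarrow> int m dvd z"
    using center_index[OF N fin] triple unfolding heis_triple_def by blast+
  have "(vector [x, y] :: int ^ 2) \<in> heis_g ` N" using xy triple by (simp add: heis_triple_def)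
  then obtain x' y' z where "(x', y', z) \<in> N" "(vector [x, y] :: int ^ 2) = vector [x', y']"
    by (auto simp: heis_g_def)
  moreover from this(2) have "x = x'" "y = y'" by (metis vector_2)+
  ultimately have z: "(x, y, z) \<in> N" by simp
  have "(0, 0, int m * \<bar>z\<bar>) \<in> N" using m(2) by simp
  from closed[OF z this] have "(x, y, z + int m * \<bar>z\<bar>) \<in> N" by simp
  moreover have "0 \<le> z + int m * \<bar>z\<bar>"
  proof -
    have "1 * \<bar>z\<bar> \<le> int m * \<bar>z\<bar>" using m(1) by (intro mult_right_mono) auto
    then show ?thesis by linarith
  qed
  ultimately have "(x, y, int (nat (z + int m * \<bar>z\<bar>))) \<in> N" by simp
  then have ex: "\<exists>k. (x, y, int k) \<in> N" by blast
  define k where "k = (LEAST k. (x, y, int k) \<in> N)"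
  have k: "(x, y, int k) \<in> N" unfolding k_def using ex by (rule LeastI_ex)
  have "i x y = (LEAST z. 0 \<le> z \<and> (x, y, z) \<in> N)" using triple xy by (simp add: heis_triple_def)
  also have "\<dots> = int k"
  proof (rule Least_equality)
    fix w assume w: "0 \<le> w \<and> (x, y, w) \<in> N"
    then have "k \<le> nat w" unfolding k_def by (intro Least_le) simp
    then show "int k \<le> w" using w by linarith
  qed (use k in simp)
  finally show ?thesis using k by simp
qed

context heis_rep_parameters
begin

lemma trivial_at_origin:
  assumes "trivial_on N" "(x, y, z) \<in> N"
  shows "int p dvd x" and "of_int y * \<xi> + of_int z * (of_int l / of_nat p) + of_int (x div int p) * \<alpha> \<in> \<int>"
proof -
  have "\<rho> (x, y, z) (unit_vec 0) 0 = unit_vec 0 0"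
    using assms unit_vec_cvecs[of 0 p] p_pos by (simp add: trivial_on_def)
  then have "circ (angle (x, y, z) 0) * unit_vec 0 (shift x 0) = 1"
    using p_pos by (simp add: rho_eq unit_vec_def)
  then have "circ (angle (x, y, z) 0) = 1" "shift x 0 = 0"
    by (auto simp: unit_vec_def split: if_splits)
  then show "int p dvd x" "of_int y * \<xi> + of_int z * (of_int l / of_nat p) + of_int (x div int p) * \<alpha> \<in> \<int>"
    using int_shift[of x 0] by (simp_all add: circ_eq_1_iff angle_def dvd_eq_mod_eq_0)
qed

lemma int_multiple_eta: "int p dvd a \<Longrightarrow> of_int a * (of_int l / real p) \<in> \<int>"
  using p_pos by (auto elim!: dvdE)

lemma real_div_p: "int p dvd x \<Longrightarrow> real_of_int (x div int p) = of_int x / of_nat p"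
  using p_pos by (auto elim!: dvdE)

text \<open>Necessity is seen at coordinate 0 of \<open>unit_vec 0\<close>, applied to \<open>(0, 0, m)\<close> and to
  \<open>(x, y, i x y)\<close>. For sufficiency, \<open>p\<close> divides \<open>m\<close>, and \<open>m\<close> divides \<open>x\<close>, \<open>y\<close> and
  \<open>z - i x y\<close> for every \<open>(x, y, z) \<in> N\<close>. So \<open>(x, y, z)\<close> permutes no coordinates, and all its
  phases agree with the one in the condition.\<close>

theorem trivial_on_iff:
  assumes N: "N \<lhd> Heis" and fin: "finite (rcosets\<^bsub>Heis\<^esub> N)" and triple: "heis_triple N A m i"
  shows "trivial_on N \<longleftrightarrow> p dvd m \<and>
    (\<forall>x y. vector [x, y] \<in> range (\<lambda>w. A *v w) \<longrightarrow>
       of_int y * \<xi> + of_int (i x y) * of_int l / of_nat p + of_int x / of_nat p * \<alpha> \<in> \<int>)"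
    (is "_ \<longleftrightarrow> _ \<and> ?phases")
proof -
  note lift = heis_triple_section[OF N fin triple]
  have center: "\<And>z. (0, 0, z) \<in> N \<longleftrightarrow> int m dvd z"
    using center_index(2)[OF N fin] triple unfolding heis_triple_def by blast
  show ?thesis
  proof (intro iffI conjI allI impI)
    assume triv: "trivial_on N"
    have "(0, 0, int m) \<in> N" using center by simp
    from trivial_at_origin(2)[OF triv this] obtain q :: int where "real m * of_int l / real p = of_int q"
      by (auto simp: Ints_def)
    then have "of_int (int m * l) = (of_int (q * int p) :: real)" using p_pos by (simp add: field_simps)
    then have "int m * l = q * int p" by (simp only: of_int_eq_iff)
    then have "int p dvd int m * l" by simp
    then show "p dvd m" using coprime by (simp add: coprime_commute coprime_dvd_mult_left_iff)
    fix x y assume "vector [x, y] \<in> range (\<lambda>w. A *v w)"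
    from trivial_at_origin[OF triv lift[OF this]]
    show "of_int y * \<xi> + of_int (i x y) * of_int l / of_nat p + of_int x / of_nat p * \<alpha> \<in> \<int>"
      by (simp add: real_div_p)
  next
    assume asm: "p dvd m \<and> ?phases"
    then have p_dvd: "int p dvd z" if "(0, 0, z) \<in> N" for z
      using that center dvd_trans[of "int p" "int m" z] by simp
    have "\<rho> h v = v" if h: "h \<in> N" and v: "v \<in> cvecs p" for h v
    proof
      fix j
      obtain x y z where xyz: "h = (x, y, z)" by (cases h)
      have "heis_g (x, y, z) \<in> heis_g ` N" using h xyz by blast
      then have range: "vector [x, y] \<in> range (\<lambda>w. A *v w)"
        using triple by (simp add: heis_triple_def heis_g_def)
      have xy: "int p dvd x" "int p dvd y"
        using normal_Heis_center[OF N h[unfolded xyz]] by (auto intro: p_dvd)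
      have "(x, y, z) \<otimes>\<^bsub>Heis\<^esub> inv\<^bsub>Heis\<^esub> (x, y, i x y) \<in> N"
        using h lift[OF range] normal_imp_subgroup[OF N]
        by (intro subgroup.m_closed subgroup.m_inv_closed) (auto simp: xyz)
      then have "(0, 0, z - i x y) \<in> N" by (simp add: inv_Heis)
      then have "int p dvd (z - i x y) + int j * y" using xy(2) by (intro dvd_add dvd_mult) (rule p_dvd)
      from int_multiple_eta[OF this]
      have eta: "of_int ((z - i x y) + int j * y) * (of_int l / real p) \<in> \<int>" .
      show "\<rho> h v j = v j"
      proof (cases "j < p")
        case True
        have div: "(x + int j) div int p = x div int p" and "shift x j = j"
          using xy True by (auto elim!: dvdE simp: shift_def)
        have "angle h j = (of_int y * \<xi> + of_int (i x y) * of_int l / of_nat p + of_int x / of_nat p * \<alpha>)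
            + of_int ((z - i x y) + int j * y) * (of_int l / real p)"
          by (simp add: xyz angle_def div real_div_p[OF xy(1)] algebra_simps diff_divide_distrib add_divide_distrib)
        also have "\<dots> \<in> \<int>"
        proof (rule Ints_add[OF _ eta])
          show "of_int y * \<xi> + of_int (i x y) * of_int l / of_nat p + of_int x / of_nat p * \<alpha> \<in> \<int>"
            using asm range by blast
        qed
        finally have "circ (angle h j) = 1" by (simp only: circ_eq_1_iff)
        then show ?thesis using True \<open>shift x j = j\<close> by (simp add: rho_eq xyz)
      next
        case False
        then show ?thesis using v by (simp add: rho_eq cvecs_def)
      qed
    qed
    then show "trivial_on N" unfolding trivial_on_def by blast
  qed
qed

end

theorem theorem5p6:
  fixes \<Gamma> :: "nat \<Rightarrow> heis set"
    and A :: "nat \<Rightarrow> int ^ 2 ^ 2" and m :: "nat \<Rightarrow> nat" and i :: "nat \<Rightarrow> int \<Rightarrow> int \<Rightarrow> int"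
    and \<mu> :: "(nat \<Rightarrow> heis set) measure"
    and \<alpha> \<xi> :: real and l :: int and p :: nat
  assumes "heis_odometer \<Gamma>"
    and "\<And>n. heis_triple (\<Gamma> n) (A n) (m n) (i n)"
    and "haar_probability (odometer_group \<Gamma>) (odometer_topology \<Gamma>) \<mu>"
    and "p \<ge> 1" and "coprime l (int p)"
  shows "in_odometer_spectrum \<mu> \<alpha> \<xi> l p \<longleftrightarrow>
    (\<exists>n. p dvd m n \<and>
       (\<forall>x y. vector [x, y] \<in> range (\<lambda>w. A n *v w) \<longrightarrow>
          of_int y * \<xi> + of_int (i n x y) * of_int l / of_nat p
            + of_int x / of_nat p * \<alpha> \<in> \<int>))"
proof -
  interpret heis_spectrum \<Gamma> \<mu> \<alpha> \<xi> l p
    by unfold_locales (use assms in auto)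
  show ?thesis
    unfolding in_spectrum_iff_trivial_on
    by (intro ex_cong1 trivial_on_iff[OF normal finite_rcosets assms(2)])
qed

end
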